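(* Let $f:\mathbb{R}^n\to\mathbb{R}^n$ be a Lipschitz mapping with Lipschitz constant $K$, and let $x_0\in\mathbb{R}^n$. Suppose that the generalized Jacobian $\partial f(x_0)$ is of maximal rank. Set $$\delta=\frac12\inf_{M_0\in\partial f(x_0)}\frac{1}{\|M_0^{-1}\|},$$ and let $r>0$ be chosen so that $f$ satisfies the Lipschitz condition $\|f(x)-f(y)\|\le K\|x-y\|$ on $\mathbf{B}^n_r(x_0)$ and $$\partial f(x)\subset\partial f(x_0)+\delta\,\mathcal{B}_{n\times n}\quad\text{when }x\in\mathbf{B}^n_r(x_0).$$ Then there exist neighborhoods $U$ and $V$ of $x_0$ and $f(x_0)$, respectively, and a Lipschitz mapping $g:V\to\mathbb{R}^n$ such that (a) $g(f(u))=u$ for every $u\in U$; (b) $f(g(v))=v$ for every $v\in V$, where $$U=\mathbf{B}^n_{\frac{r\delta}{2}\cdot\frac1K}(x_0),\qquad V=\mathbf{B}^n_{\frac{r\delta}{2}}(f(x_0)),\qquad L(g)=\frac1\delta.$$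
   Context: $\|\cdot\|$ on $\mathbb{R}^n$ is the Euclidean norm, and for a matrix $A$, $\|A\|=\max_{\|x\|=1}\|Ax\|$ is the operator norm. $\mathbf{B}^n_\rho(a)$ is the ball of radius $\rho$ centered at $a\in\mathbb{R}^n$. $\mathcal{B}_{n\times n}$ is the unit ball of the space of real $n\times n$ matrices with the operator norm; sums of sets are Minkowski sums. $L(g)$ denotes the Lipschitz constant of a mapping $g$, defined by $L(g)=\sup\left\{\frac{\|g(x)-g(y)\|}{\|x-y\|}: x\ne y\right\}$, with $x,y$ ranging over the domain of $g$. For a mapping $f$ that is Lipschitz near a point $x$ (hence differentiable almost everywhere near $x$ by Rademacher's theorem), $Jf$ denotes the usual Jacobian matrix where it exists. The generalized Jacobian $\partial f(x)$ (Clarke) is the convex hull of all matrices of the form $\lim_{i\to\infty}Jf(x_i)$, where $x_i\to x$ and $f$ is differentiable at each $x_i$. $\partial f(x_0)$ is said to be of maximal rank if every matrix $M\in\partial f(x_0)$ has maximal rank (here: is invertible).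
   Formalization: The equality L(g) = 1/δ is replaced by L(g) ≤ 1/δ, since equality fails, for example for f = id with K = 1, where δ = 1/2 and g = id has L(g) = 1 while 1/δ = 2. *)

theory Defs
  imports "HOL-Analysis.Analysis" "HOL-Library.Set_Algebras"
begin

text \<open>The norm of the type \<^typ>\<open>real^'n^'m\<close> is the Frobenius norm, so the operator norm is
  expressed through \<^const>\<open>onorm\<close>.\<close>

definition op_norm :: "real^'n^'m \<Rightarrow> real" where
  "op_norm A = onorm ((*v) A)"

definition op_unit_ball :: "(real^'n^'m) set" where
  "op_unit_ball = {A. op_norm A \<le> 1}"

text \<open>The limit is independent of the choice of the norm on the finite-dimensional
  space of matrices.\<close>

definition generalized_jacobian :: "(real^'n \<Rightarrow> real^'m) \<Rightarrow> real^'n \<Rightarrow> (real^'n^'m) set" where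
  "generalized_jacobian f x =
     convex hull {M. \<exists>X :: nat \<Rightarrow> real^'n. X \<longlonglongrightarrow> x \<and> (\<forall>i. f differentiable (at (X i)))
                       \<and> (\<lambda>i. jacobian f (at (X i))) \<longlonglongrightarrow> M}"

text \<open>Extended nonnegative values, so that the supremum is \<^term>\<open>\<infinity>::ennreal\<close> exactly when the map is
  not Lipschitz on the domain \<^term>\<open>D\<close>. (Functions being total, the domain is an argument.)\<close>

definition lipschitz_constant ::
    "'a::real_normed_vector set \<Rightarrow> ('a \<Rightarrow> 'b::real_normed_vector) \<Rightarrow> ennreal" where
  "lipschitz_constant D g =
     (SUP (x, y)\<in>{(x, y). x \<in> D \<and> y \<in> D \<and> x \<noteq> y}. ennreal (norm (g x - g y) / norm (x - y)))"

end

theory Submission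
  imports Defs
begin

text \<open>Fix \<open>x \<noteq> y\<close> in the ball around \<open>x0\<close>. The vectors \<open>M (y - x)\<close>, where \<open>M\<close> ranges over the
  generalized Jacobian at \<open>x0\<close>, form a compact convex set at distance at least \<open>2 \<delta> \<parallel>y - x\<parallel>\<close> from
  \<open>0\<close>, so some unit vector \<open>w\<close> satisfies \<open>w \<bullet> M (y - x) \<ge> 2 \<delta> \<parallel>y - x\<parallel>\<close> for all of them, and
  \<open>w \<bullet> J (y - x) \<ge> \<delta> \<parallel>y - x\<parallel>\<close> for every Jacobian \<open>J\<close> of \<open>f\<close> in the ball. Integrating along segments
  parallel to \<open>y - x\<close>, almost all of which meet the non-differentiability points in a null set by the
  theorems of Rademacher and Fubini, gives \<open>\<parallel>f y - f x\<parallel> \<ge> \<delta> \<parallel>y - x\<parallel>\<close>. Invariance of domain and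
  connectedness of balls turn this expansion into surjectivity onto the ball \<open>V\<close>.

  Rademacher's theorem reduces to dimension one. Lipschitz functions on the line are differentiable
  almost everywhere by Vitali's covering theorem, and Fubini yields derivatives along lines almost
  everywhere. Applied to the distance from a set \<open>A\<close>, this shows that almost no point of \<open>A\<close> is a
  porosity point of \<open>A\<close>. Now split the space into countably many closed sets \<open>A\<close> on which the
  difference quotients along the basis vectors are uniformly close to a fixed vector: near a
  non-porosity point of such an \<open>A\<close>, a path of coordinate steps can start each step at a point of \<open>A\<close>
  with negligible error.\<close>

section \<open>Lipschitz functions on the line\<close>

text \<open>By Vitali, disjoint intervals from the cover, all inside an open \<open>U\<close>
  containing \<open>E\<close>, exhaust \<open>E\<close> up to a null set. Strict monotonicity keeps
  their images disjoint, so the image lengths add up to at most \<open>p\<close> times the measure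
  of \<open>U\<close>; the Lipschitz bound makes the image of the remainder null. Outer regularity
  then shrinks \<open>U\<close> to \<open>E\<close>.\<close>

lemma emeasure_strict_mono_image_le:
  fixes g :: "real \<Rightarrow> real"
  assumes mono: "strict_mono g" and lip: "L-lipschitz_on UNIV g"
    and E: "E \<in> sets borel" and gE: "g ` E \<in> sets borel" and p: "0 \<le> p"
    and cover: "\<And>x d. x \<in> E \<Longrightarrow> 0 < d \<Longrightarrow>
      \<exists>a b. a < b \<and> b - a < d \<and> a \<le> x \<and> x \<le> b \<and> g b - g a \<le> p * (b - a)"
  shows "emeasure lborel (g ` E) \<le> ennreal p * emeasure lborel E"
proof -
  have le_open: "emeasure lborel (g ` E) \<le> ennreal p * emeasure lborel U"
    if "open U" "E \<subseteq> U" for U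
  proof -
    \<comment> \<open>Intervals are encoded by their endpoints; midpoint \<open>c\<close> and
      half-length \<open>s\<close> present them as the balls of Vitali's theorem.\<close>
    define I where "I = {(a, b). a < b \<and> {a..b} \<subseteq> U \<and> g b - g a \<le> p * (b - a)}"
    define c where "c = (\<lambda>(a, b). (a + b) / 2 :: real)"
    define s where "s = (\<lambda>(a, b). (b - a) / 2 :: real)"
    have cball: "cball (c i) (s i) = {fst i..snd i}" for i
      by (cases i) (auto simp: c_def s_def cball_eq_atLeastAtMost field_simps)
    have fine: "\<exists>i. i \<in> I \<and> x \<in> cball (c i) (s i) \<and> s i < d" if x: "x \<in> E" "0 < d" for x d
    proof -
      obtain e where e: "0 < e" "ball x e \<subseteq> U"
        using \<open>open U\<close> \<open>E \<subseteq> U\<close> x(1) by (meson openE subsetD)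
      obtain a b where ab: "a < b" "b - a < min d e" "a \<le> x" "x \<le> b" "g b - g a \<le> p * (b - a)"
        using cover[OF x(1), of "min d e"] x(2) e(1) by auto
      have "{a..b} \<subseteq> ball x e"
        using ab by (auto simp: dist_real_def abs_if)
      with e ab have "(a, b) \<in> I" by (auto simp: I_def)
      moreover have "x \<in> cball (c (a, b)) (s (a, b))" using ab by (simp add: cball)
      moreover have "s (a, b) < d" using ab by (simp add: s_def)
      ultimately show ?thesis by blast
    qed
    obtain C where C: "countable C" "C \<subseteq> I"
      "pairwise (\<lambda>i j. disjnt (cball (c i) (s i)) (cball (c j) (s j))) C"
      "negligible (E - (\<Union>i\<in>C. cball (c i) (s i)))"
    proof (rule Vitali_covering_theorem_cballs[of I s E c])
      show "0 < s i" if "i \<in> I" for i using that by (auto simp: I_def s_def)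
    qed (use fine in auto)
    have IC: "fst i < snd i" "{fst i..snd i} \<subseteq> U" "g (snd i) - g (fst i) \<le> p * (snd i - fst i)"
      if "i \<in> C" for i
      using subsetD[OF C(2) that] by (auto simp: I_def)
    have apart: "snd i < fst j \<or> snd j < fst i" if "i \<in> C" "j \<in> C" "i \<noteq> j" for i j
    proof -
      have "disjnt {fst i..snd i} {fst j..snd j}"
        using C(3) that unfolding cball pairwise_def by auto
      then show ?thesis
        using IC(1)[OF that(1)] IC(1)[OF that(2)] by (auto simp: disjnt_def)
    qed
    define N where "N = E - (\<Union>i\<in>C. {fst i..snd i})"
    have "negligible N" using C(4) by (simp add: N_def cball)
    have "negligible (g ` N)"
    proof (rule negligible_locally_Lipschitz_image[OF _ \<open>negligible N\<close>])
      show "\<exists>T B. open T \<and> x \<in> T \<and> (\<forall>y\<in>N \<inter> T. norm (g y - g x) \<le> B * norm (y - x))" for x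
        using lipschitz_onD[OF lip] by (intro exI[of _ UNIV] exI[of _ L]) (auto simp: dist_norm)
    qed simp
    then have gN: "g ` N \<in> null_sets lebesgue" by (simp add: negligible_iff_null_sets)
    let ?J = "\<Union>i\<in>C. {g (fst i)..g (snd i)}"
    have J: "?J \<in> sets borel" using C(1) by (intro sets.countable_UN'') auto
    have "emeasure lborel (g ` E) = emeasure lebesgue (g ` E)"
      using gE by simp
    also have "\<dots> \<le> emeasure lebesgue (g ` N \<union> ?J)"
    proof (rule emeasure_mono)
      show "g ` E \<subseteq> g ` N \<union> ?J"
        using strict_mono_less_eq[OF mono] by (fastforce simp: N_def)
      show "g ` N \<union> ?J \<in> sets lebesgue"
        using gN J by (intro sets.Un) auto
    qed
    also have "\<dots> \<le> emeasure lebesgue (g ` N) + emeasure lebesgue ?J"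
      using gN J by (intro emeasure_subadditive) auto
    also have "\<dots> = emeasure lborel ?J"
      using gN J by (simp add: null_setsD1)
    also have "\<dots> = (\<integral>\<^sup>+i. emeasure lborel {g (fst i)..g (snd i)} \<partial>count_space C)"
    proof (rule emeasure_UN_countable)
      show "disjoint_family_on (\<lambda>i. {g (fst i)..g (snd i)}) C"
        unfolding disjoint_family_on_def
      proof (intro ballI impI)
        fix i j assume "i \<in> C" "j \<in> C" "i \<noteq> j"
        from apart[OF this] have "g (snd i) < g (fst j) \<or> g (snd j) < g (fst i)"
          using mono by (auto simp: strict_mono_less)
        then show "{g (fst i)..g (snd i)} \<inter> {g (fst j)..g (snd j)} = {}" by auto
      qed
    qed (use C(1) in auto)
    also have "\<dots> \<le> (\<integral>\<^sup>+i. ennreal p * emeasure lborel {fst i..snd i} \<partial>count_space C)"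
    proof (rule nn_integral_mono)
      fix i assume "i \<in> space (count_space C)"
      then have i: "i \<in> C" by simp
      have "g (fst i) \<le> g (snd i)" using IC(1)[OF i] mono by (simp add: strict_mono_less_eq)
      then show "emeasure lborel {g (fst i)..g (snd i)} \<le> ennreal p * emeasure lborel {fst i..snd i}"
        using IC(1,3)[OF i] p by (simp add: ennreal_mult[symmetric] ennreal_leI)
    qed
    also have "\<dots> = ennreal p * (\<integral>\<^sup>+i. emeasure lborel {fst i..snd i} \<partial>count_space C)"
      by (rule nn_integral_cmult) simp
    also have "(\<integral>\<^sup>+i. emeasure lborel {fst i..snd i} \<partial>count_space C)
        = emeasure lborel (\<Union>i\<in>C. {fst i..snd i})"
    proof (rule emeasure_UN_countable[symmetric])
      show "disjoint_family_on (\<lambda>i. {fst i..snd i}) C"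
        using apart by (fastforce simp: disjoint_family_on_def)
    qed (use C(1) in auto)
    also have "\<dots> \<le> emeasure lborel U"
      using IC(2) \<open>open U\<close> by (intro emeasure_mono) auto
    finally show ?thesis by (simp add: mult_left_mono)
  qed
  show ?thesis
  proof (rule ennreal_le_epsilon)
    fix e :: real assume "0 < e"
    \<comment> \<open>The denominator is \<open>p + 1\<close> because \<open>p\<close> may be
      0.\<close>
    then have "0 < e / (p + 1)" using p by simp
    then obtain U where U: "open U" "E \<subseteq> U" "emeasure lborel (U - E) < e / (p + 1)"
      using outer_regular_lborel[OF E] by blast
    have "emeasure lborel U \<le> emeasure lborel E + emeasure lborel (U - E)"
    proof -
      have "emeasure lborel (E \<union> (U - E)) \<le> emeasure lborel E + emeasure lborel (U - E)"
        using U(1) E by (intro emeasure_subadditive) auto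
      moreover have "E \<union> (U - E) = U" using U(2) by auto
      ultimately show ?thesis by simp
    qed
    also have "\<dots> \<le> emeasure lborel E + ennreal (e / (p + 1))"
      using U(3) by (intro add_left_mono) simp
    finally have "emeasure lborel (g ` E) \<le> ennreal p * (emeasure lborel E + ennreal (e / (p + 1)))"
      using le_open[OF U(1,2)] by (meson mult_left_mono order_trans zero_le)
    also have "\<dots> = ennreal p * emeasure lborel E + ennreal (p * (e / (p + 1)))"
      using p \<open>0 < e\<close> by (simp add: distrib_left ennreal_mult[symmetric])
    also have "\<dots> \<le> ennreal p * emeasure lborel E + ennreal e"
      using p \<open>0 < e\<close> by (intro add_left_mono ennreal_leI) (simp add: field_simps)
    finally show "emeasure lborel (g ` E) \<le> ennreal p * emeasure lborel E + ennreal e" .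
  qed
qed

lemma expanding_real:
  fixes g :: "real \<Rightarrow> real"
  assumes cont: "continuous_on UNIV g" and expand: "\<And>x y. x < y \<Longrightarrow> y - x \<le> g y - g x"
  shows "strict_mono g" "bij g" "1-lipschitz_on UNIV (inv g)"
proof -
  show mono: "strict_mono g"
    using expand by (fastforce simp: strict_mono_def)
  have "\<exists>x. g x = y" for y
  proof -
    \<comment> \<open>Expansion from 0 gives \<open>g (- R) \<le> g 0 - R \<le> y\<close> and
      \<open>y \<le> g 0 + R \<le> g R\<close>, as the intermediate value theorem requires.\<close>
    define R where "R = \<bar>y\<bar> + \<bar>g 0\<bar> + 1"
    have "g (- R) \<le> y" "y \<le> g R" "- R \<le> R"
      using expand[of "- R" 0] expand[of 0 R] unfolding R_def by arith+
    then show ?thesis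
      using IVT'[of g "- R" y R] cont continuous_on_subset by blast
  qed
  then have "surj g" by (metis surjI)
  then show bij: "bij g"
    using strict_mono_imp_inj_on[OF mono] by (simp add: bij_def)
  show "1-lipschitz_on UNIV (inv g)"
  proof (rule lipschitz_onI)
    fix x y
    have "\<bar>a - b\<bar> \<le> \<bar>g a - g b\<bar>" for a b
      using expand[of a b] expand[of b a] by (cases a b rule: linorder_cases) auto
    from this[of "inv g x" "inv g y"] show "dist (inv g x) (inv g y) \<le> 1 * dist x y"
      using \<open>surj g\<close> by (simp add: dist_real_def surj_f_inv_f)
  qed simp
qed

text \<open>The image is a preimage under the inverse, which is 1-Lipschitz and hence
  continuous.\<close>

lemma borel_image_expanding:
  fixes g :: "real \<Rightarrow> real"
  assumes "continuous_on UNIV g" "\<And>x y. x < y \<Longrightarrow> y - x \<le> g y - g x" "E \<in> sets borel"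
  shows "g ` E \<in> sets borel"
proof -
  note g = expanding_real[OF assms(1,2)]
  have "g ` E = inv g -` E"
    by (metis bij_vimage_eq_inv_image bij_imp_bij_inv inv_inv_eq g(2))
  moreover have "inv g \<in> borel_measurable borel"
    using g(3) by (intro borel_measurable_continuous_onI lipschitz_on_continuous_on)
  ultimately show ?thesis
    using assms(3) measurable_sets[of "inv g" borel borel E] by simp
qed

text \<open>This is the upper estimate for images applied to the inverse function: increments of
  \<open>g\<close> of at least \<open>q\<close> times the length become increments of
  \<open>inv g\<close> of at most \<open>1 / q\<close> times the length.\<close>

lemma emeasure_expanding_image_ge:
  fixes g :: "real \<Rightarrow> real"
  assumes lip: "L-lipschitz_on UNIV g" and expand: "\<And>x y. x < y \<Longrightarrow> y - x \<le> g y - g x"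
    and E: "E \<in> sets borel" and q: "0 < q"
    and cover: "\<And>x d. x \<in> E \<Longrightarrow> 0 < d \<Longrightarrow>
      \<exists>a b. a < b \<and> b - a < d \<and> a \<le> x \<and> x \<le> b \<and> q * (b - a) \<le> g b - g a"
  shows "ennreal q * emeasure lborel E \<le> emeasure lborel (g ` E)"
proof -
  have cont: "continuous_on UNIV g" using lip by (rule lipschitz_on_continuous_on)
  note g = expanding_real[OF cont expand]
  have inv [simp]: "inv g (g x) = x" for x using g(2) by (simp add: bij_is_inj inv_f_f)
  have L: "1 \<le> L"
    using lipschitz_onD[OF lip, of 0 1] expand[of 0 1] by (auto simp: dist_real_def)
  have im: "inv g ` g ` E = E" by (simp add: image_image)
  have "emeasure lborel (inv g ` g ` E) \<le> ennreal (1 / q) * emeasure lborel (g ` E)"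
  proof (rule emeasure_strict_mono_image_le)
    show "strict_mono (inv g)"
      using g(1,2) by (simp add: strict_mono_inv bij_is_surj)
    show "g ` E \<in> sets borel" by (rule borel_image_expanding[OF cont expand E])
    fix y d :: real assume "y \<in> g ` E" "0 < d"
    then obtain x where x: "x \<in> E" "y = g x" by auto
    \<comment> \<open>The scale \<open>d / L\<close> ensures that the image interval is shorter than
      \<open>d\<close>.\<close>
    obtain a b where ab: "a < b" "b - a < d / L" "a \<le> x" "x \<le> b" "q * (b - a) \<le> g b - g a"
      using cover[OF x(1), of "d / L"] \<open>0 < d\<close> L by auto
    have "g b - g a \<le> L * (b - a)"
      using lipschitz_onD[OF lip, of a b] ab(1) by (auto simp: dist_real_def)
    also have "\<dots> < d" using ab(2) L by (simp add: field_simps)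
    finally show "\<exists>a b. a < b \<and> b - a < d \<and> a \<le> y \<and> y \<le> b \<and> inv g b - inv g a \<le> 1 / q * (b - a)"
      using ab x(2) q g(1)
      by (intro exI[of _ "g a"] exI[of _ "g b"])
         (auto simp: strict_mono_less strict_mono_less_eq field_simps)
  qed (use g(3) E q im in auto)
  then have "ennreal q * emeasure lborel E \<le> ennreal q * (ennreal (1 / q) * emeasure lborel (g ` E))"
    unfolding im by (intro mult_left_mono) auto
  also have "\<dots> = emeasure lborel (g ` E)"
    using q by (simp add: mult.assoc[symmetric] ennreal_mult[symmetric])
  finally show ?thesis .
qed

text \<open>A summand of slope \<open>K + 1\<close> outweighs any decrease of \<open>f\<close>. The
  sum is expanding, so the image estimates apply to it, and every difference quotient is shifted by
  the same amount.\<close>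

lemma lipschitz_add_linear:
  fixes f :: "real \<Rightarrow> real"
  assumes "K-lipschitz_on UNIV f"
  shows "(2 * K + 1)-lipschitz_on UNIV (\<lambda>x. f x + (K + 1) * x)"
    and "x < y \<Longrightarrow> y - x \<le> (f y + (K + 1) * y) - (f x + (K + 1) * x)"
proof -
  have K: "0 \<le> K" using assms lipschitz_on_nonneg by blast
  have "(K + 1)-lipschitz_on UNIV (\<lambda>x. (K + 1) * x)"
    using K by (intro lipschitz_onI) (auto simp: dist_real_def abs_mult right_diff_distrib[symmetric])
  from lipschitz_on_add[OF assms this] show "(2 * K + 1)-lipschitz_on UNIV (\<lambda>x. f x + (K + 1) * x)"
    by (simp add: algebra_simps)
  show "y - x \<le> (f y + (K + 1) * y) - (f x + (K + 1) * x)" if "x < y"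
    using lipschitz_onD[OF assms, of x y] that by (auto simp: dist_real_def algebra_simps)
qed

section \<open>Oscillation of difference quotients\<close>

definition quotient_oscillation :: "('a::real_normed_vector \<Rightarrow> real) \<Rightarrow> 'a \<Rightarrow> real \<Rightarrow> real \<Rightarrow> 'a set" where
  "quotient_oscillation f v p q =
     {x. \<forall>n::nat. (\<exists>h. h \<noteq> 0 \<and> \<bar>h\<bar> < inverse (real (Suc n)) \<and> (f (x + h *\<^sub>R v) - f x) / h < p) \<and>
                   (\<exists>h. h \<noteq> 0 \<and> \<bar>h\<bar> < inverse (real (Suc n)) \<and> q < (f (x + h *\<^sub>R v) - f x) / h)}"

text \<open>Only the countably many scales \<open>inverse (real (Suc n))\<close> occur, and for each
  fixed scale the conditions are unions of open sets over \<open>h\<close>; the set is therefore a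
  countable intersection of open sets.\<close>

lemma borel_quotient_oscillation:
  assumes "continuous_on UNIV f"
  shows "quotient_oscillation f v p q \<in> sets borel"
proof -
  let ?Q = "\<lambda>h x. (f (x + h *\<^sub>R v) - f x) / h"
  have cont: "continuous_on UNIV (?Q h)" for h
    unfolding divide_inverse
    by (intro continuous_intros continuous_on_compose2[OF assms] assms) auto
  have "quotient_oscillation f v p q =
    (\<Inter>n::nat. (\<Union>h\<in>{h. h \<noteq> 0 \<and> \<bar>h\<bar> < inverse (real (Suc n))}. {x. ?Q h x < p}) \<inter>
              (\<Union>h\<in>{h. h \<noteq> 0 \<and> \<bar>h\<bar> < inverse (real (Suc n))}. {x. q < ?Q h x}))"
    by (auto simp: quotient_oscillation_def)
  also have "\<dots> \<in> sets borel"
    by (intro sets.countable_INT'' sets.Int borel_open open_UN ballI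
          open_Collect_less cont continuous_on_const) auto
  finally show ?thesis .
qed

lemma interval_of_quotient_less:
  fixes f :: "real \<Rightarrow> real"
  assumes "h \<noteq> 0" "\<bar>h\<bar> < d" "(f (x + h) - f x) / h < p"
  shows "\<exists>a b. a < b \<and> b - a < d \<and> a \<le> x \<and> x \<le> b \<and> f b - f a < p * (b - a)"
proof (cases "0 < h")
  case True
  then show ?thesis using assms
    by (intro exI[of _ x] exI[of _ "x + h"]) (auto simp: field_simps)
next
  case False
  then show ?thesis using assms
    by (intro exI[of _ "x + h"] exI[of _ x]) (auto simp: field_simps)
qed

lemma negligible_quotient_oscillation_real:
  fixes f :: "real \<Rightarrow> real"
  assumes lip: "K-lipschitz_on UNIV f" and pq: "p < q"
  shows "negligible (quotient_oscillation f 1 p q)"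
proof -
  define S where "S = quotient_oscillation f 1 p q"
  define g where "g x = f x + (K + 1) * x" for x
  have K: "0 \<le> K" using lip lipschitz_on_nonneg by blast
  have glip: "(2 * K + 1)-lipschitz_on UNIV g"
    unfolding g_def by (rule lipschitz_add_linear(1)[OF lip])
  have expand: "y - x \<le> g y - g x" if "x < y" for x y
    unfolding g_def by (rule lipschitz_add_linear(2)[OF lip that])
  have gcont: "continuous_on UNIV g" using glip by (rule lipschitz_on_continuous_on)
  have S: "S \<in> sets borel"
    unfolding S_def by (intro borel_quotient_oscillation lipschitz_on_continuous_on[OF lip])
  define p' where "p' = p + K + 1"
  define q' where "q' = q + K + 1"
  have low: "\<exists>a b. a < b \<and> b - a < d \<and> a \<le> x \<and> x \<le> b \<and> g b - g a < p' * (b - a)"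
    if "x \<in> S" "0 < d" for x d
  proof -
    obtain n where n: "inverse (real (Suc n)) < d" using reals_Archimedean[OF \<open>0 < d\<close>] by blast
    obtain h where "h \<noteq> 0" "\<bar>h\<bar> < inverse (real (Suc n))" "(f (x + h) - f x) / h < p"
      using \<open>x \<in> S\<close> unfolding S_def quotient_oscillation_def mem_Collect_eq
      by (auto dest!: spec[of _ n])
    with n have "h \<noteq> 0" "\<bar>h\<bar> < d" "(f (x + h) - f x) / h < p" by linarith+
    from interval_of_quotient_less[OF this] obtain a b
      where ab: "a < b" "b - a < d" "a \<le> x" "x \<le> b" "f b - f a < p * (b - a)" by blast
    then have "g b - g a < p' * (b - a)" by (simp add: g_def p'_def algebra_simps)
    with ab show ?thesis by blast
  qed
  have high: "\<exists>a b. a < b \<and> b - a < d \<and> a \<le> x \<and> x \<le> b \<and> q' * (b - a) < g b - g a"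
    if "x \<in> S" "0 < d" for x d
  proof -
    obtain n where n: "inverse (real (Suc n)) < d" using reals_Archimedean[OF \<open>0 < d\<close>] by blast
    obtain h where "h \<noteq> 0" "\<bar>h\<bar> < inverse (real (Suc n))" "q < (f (x + h) - f x) / h"
      using \<open>x \<in> S\<close> unfolding S_def quotient_oscillation_def mem_Collect_eq
      by (auto dest!: spec[of _ n])
    \<comment> \<open>Passing to \<open>- f\<close> turns the large quotients into small
      ones.\<close>
    with n have "h \<noteq> 0" "\<bar>h\<bar> < d" "(- f (x + h) - - f x) / h < - q"
      by (simp_all add: diff_divide_distrib)
    from interval_of_quotient_less[OF this] obtain a b
      where ab: "a < b" "b - a < d" "a \<le> x" "x \<le> b" "- f b - - f a < - q * (b - a)" by blast
    then have "q' * (b - a) < g b - g a" by (simp add: g_def q'_def algebra_simps)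
    with ab show ?thesis by blast
  qed
  have "emeasure lborel (S \<inter> {- real n..real n}) = 0" for n
  proof (cases "S = {}")
    case False
    then obtain x where "x \<in> S" by blast
    from low[OF this zero_less_one] obtain a b where "a < b" "g b - g a < p' * (b - a)" by blast
    \<comment> \<open>An expanding function cannot have an increment below
      \<open>p' * (b - a)\<close> unless \<open>p'\<close> is positive.\<close>
    then have "0 < p' * (b - a)" using expand[of a b] by linarith
    then have p': "0 < p'" using \<open>a < b\<close> by (simp add: zero_less_mult_iff)
    have q': "p' < q'" using pq by (simp add: p'_def q'_def)
    let ?E = "S \<inter> {- real n..real n}"
    have E: "?E \<in> sets borel" using S by simp
    have "emeasure lborel ?E \<le> emeasure lborel {- real n..real n}"
      using E by (intro emeasure_mono) auto
    then have fin: "emeasure lborel ?E < \<infinity>" by (simp add: le_less_trans[OF _ ennreal_less_top])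
    then obtain m where m: "0 \<le> m" "emeasure lborel ?E = ennreal m"
      by (metis ennreal_cases infinity_ennreal_def less_irrefl)
    have "ennreal q' * emeasure lborel ?E \<le> emeasure lborel (g ` ?E)"
    proof (rule emeasure_expanding_image_ge[OF glip expand E])
      show "0 < q'" using p' q' by simp
      show "\<exists>a b. a < b \<and> b - a < d \<and> a \<le> x \<and> x \<le> b \<and> q' * (b - a) \<le> g b - g a"
        if "x \<in> ?E" "0 < d" for x d
        using high[of x d] that by (meson IntD1 less_imp_le)
    qed
    also have "\<dots> \<le> ennreal p' * emeasure lborel ?E"
    proof (rule emeasure_strict_mono_image_le[OF expanding_real(1)[OF gcont expand] glip E])
      show "g ` ?E \<in> sets borel" by (rule borel_image_expanding[OF gcont expand E])
      show "0 \<le> p'" using p' by simp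
      show "\<exists>a b. a < b \<and> b - a < d \<and> a \<le> x \<and> x \<le> b \<and> g b - g a \<le> p' * (b - a)"
        if "x \<in> ?E" "0 < d" for x d
        using low[of x d] that by (meson IntD1 less_imp_le)
    qed
    finally have "q' * m \<le> p' * m"
      using m p' q' by (simp add: ennreal_mult[symmetric])
    then have "m \<le> 0" using q' by (simp add: mult_le_cancel_right)
    with m(1) have "m = 0" by simp
    with m show ?thesis by simp
  qed (simp)
  then have "negligible (S \<inter> {- real n..real n})" for n
    using S by (subst negligible_iff_null_sets) (auto simp: null_sets_def)
  then have "negligible (\<Union>n. S \<inter> {- real n..real n})"
    by (intro negligible_countable_Union) auto
  moreover have "S \<subseteq> (\<Union>n. S \<inter> {- real n..real n})"
  proof
    fix x assume "x \<in> S"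
    obtain n where "\<bar>x\<bar> \<le> real n" using real_arch_simple by blast
    then have "x \<in> {- real n..real n}" by (simp add: abs_le_iff)
    with \<open>x \<in> S\<close> show "x \<in> (\<Union>n. S \<inter> {- real n..real n})" by blast
  qed
  ultimately show ?thesis
    unfolding S_def using negligible_subset by blast
qed

text \<open>Applied to the expanding function \<^term>\<open>\<lambda>x. h x + (K + 1) * x\<close>, the covering argument replaces
  the fundamental theorem of calculus for absolutely continuous functions.\<close>

lemma lipschitz_increment_ge:
  fixes h :: "real \<Rightarrow> real"
  assumes lip: "K-lipschitz_on UNIV h" and N: "negligible N"
    and deriv: "\<And>t. t \<in> {0..1} \<Longrightarrow> t \<notin> N \<Longrightarrow> \<exists>D\<ge>c. (h has_real_derivative D) (at t)"
  shows "c \<le> h 1 - h 0"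
proof (rule field_le_epsilon)
  fix e :: real assume "0 < e"
  \<comment> \<open>Capping the error at 1 settles the case below in which the shifted slope is not
    positive: there \<open>c \<le> - K\<close>, and the Lipschitz bound suffices.\<close>
  define e' where "e' = min e 1"
  have e': "0 < e'" "e' \<le> e" "e' \<le> 1" using \<open>0 < e\<close> by (auto simp: e'_def)
  define g where "g x = h x + (K + 1) * x" for x
  have K: "0 \<le> K" using lip lipschitz_on_nonneg by blast
  have glip: "(2 * K + 1)-lipschitz_on UNIV g"
    unfolding g_def by (rule lipschitz_add_linear(1)[OF lip])
  have expand: "y - x \<le> g y - g x" if "x < y" for x y
    unfolding g_def by (rule lipschitz_add_linear(2)[OF lip that])
  have gcont: "continuous_on UNIV g" using glip by (rule lipschitz_on_continuous_on)
  note g = expanding_real[OF gcont expand]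
  show "c \<le> h 1 - h 0 + e"
  proof (cases "c + K + 1 - e' \<le> 0")
    case True
    have "- K \<le> h 1 - h 0" using lipschitz_onD[OF lip, of 0 1] by (auto simp: dist_real_def)
    with True e' show ?thesis by linarith
  next
    case False
    define q where "q = c + K + 1 - e'"
    have q: "0 < q" using False by (simp add: q_def)
    have "N \<in> null_sets (completion lborel)" using N by (simp add: negligible_iff_null_sets)
    \<comment> \<open>A Borel null set around \<open>N\<close> makes \<open>E\<close> Borel without
      changing its measure, which is 1.\<close>
    then obtain N' where N': "N' \<in> null_sets lborel" "N \<subseteq> N'"
      unfolding null_sets_completion_iff2 by blast
    define E where "E = {0..1} - N'"
    have E: "E \<in> sets borel" using null_setsD2[OF N'(1)] by (simp add: E_def)
    have "emeasure lborel {0..1::real} = emeasure lborel E"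
      unfolding E_def using N'(1) by (intro emeasure_Diff_null_set[symmetric]) auto
    then have "ennreal q = ennreal q * emeasure lborel E" by simp
    also have "\<dots> \<le> emeasure lborel (g ` E)"
    proof (rule emeasure_expanding_image_ge[OF glip expand E q])
      fix x d :: real assume x: "x \<in> E" and "0 < d"
      then obtain D where D: "c \<le> D" "(h has_real_derivative D) (at x)"
        using deriv[of x] N'(2) by (auto simp: E_def)
      then have "((\<lambda>k. (h (x + k) - h x) / k) \<longlongrightarrow> D) (at 0)" by (simp add: DERIV_def)
      moreover have "c - e' < D" using D(1) e' by linarith
      ultimately have "\<forall>\<^sub>F k in at 0. c - e' < (h (x + k) - h x) / k" by (rule order_tendstoD)
      then obtain b where b: "0 < b" "\<And>k. k \<noteq> 0 \<Longrightarrow> \<bar>k\<bar> < b \<Longrightarrow> c - e' < (h (x + k) - h x) / k"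
        by (auto simp: eventually_at dist_real_def)
      define k where "k = min b d / 2"
      have k: "0 < k" "k < b" "k < d" using b(1) \<open>0 < d\<close> by (auto simp: k_def)
      have "(c - e') * k < h (x + k) - h x"
        using b(2)[of k] k by (simp add: field_simps)
      then show "\<exists>a b. a < b \<and> b - a < d \<and> a \<le> x \<and> x \<le> b \<and> q * (b - a) \<le> g b - g a"
        using k by (intro exI[of _ x] exI[of _ "x + k"]) (auto simp: g_def q_def algebra_simps)
    qed
    \<comment> \<open>The interval has length \<open>h 1 - h 0 + K + 1\<close>, so comparison with
      \<open>q\<close> returns \<open>c - e' \<le> h 1 - h 0\<close>.\<close>
    also have "\<dots> \<le> emeasure lborel {g 0..g 1}"
      using g(1) by (intro emeasure_mono) (auto simp: E_def strict_mono_less_eq)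
    also have "\<dots> = ennreal (g 1 - g 0)"
      using expand[of 0 1] by simp
    finally have "q \<le> g 1 - g 0" using expand[of 0 1] by (simp add: ennreal_le_iff)
    then show ?thesis using e' by (simp add: q_def g_def)
  qed
qed

section \<open>Derivatives along lines\<close>

lemma borel_negligible_iff_AE:
  fixes N :: "'a::euclidean_space set"
  assumes "N \<in> sets borel"
  shows "negligible N \<longleftrightarrow> (AE x in lborel. x \<notin> N)"
  using assms by (simp add: negligible_iff_null_sets null_sets_def AE_iff_null_sets[symmetric])

lemma AE_lborel_translate:
  fixes N :: "'a::euclidean_space set"
  assumes "N \<in> sets borel"
  shows "(AE x in lborel. x + a \<notin> N) \<longleftrightarrow> (AE x in lborel. x \<notin> N)"
proof -
  have "(AE x in distr lborel borel ((+) a). x \<notin> N) \<longleftrightarrow> (AE x in lborel. a + x \<notin> N)"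
    by (rule AE_distr_iff) (use assms in \<open>auto simp: Compl_eq[symmetric]\<close>)
  then show ?thesis by (simp only: lborel_distr_plus add.commute[of a])
qed

text \<open>Fubini is needed only for the shear \<^term>\<open>\<lambda>(x, t). x + t *\<^sub>R v\<close>; translation invariance then
  removes the dependence on \<^term>\<open>t\<close>.\<close>

lemma negligible_iff_AE_lines:
  fixes N :: "'a::euclidean_space set"
  assumes N: "N \<in> sets borel"
  shows "negligible N \<longleftrightarrow> (AE x in lborel. negligible {t::real. x + t *\<^sub>R v \<in> N})"
proof -
  have slice: "{t::real. x + t *\<^sub>R v \<in> N} \<in> sets borel" for x
  proof -
    have "(\<lambda>t::real. x + t *\<^sub>R v) \<in> borel_measurable borel" by simp
    from measurable_sets[OF this N] show ?thesis by (simp add: vimage_def)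
  qed
  have "(\<lambda>z::'a \<times> real. fst z + snd z *\<^sub>R v) \<in> borel_measurable borel"
    by (intro borel_measurable_continuous_onI continuous_intros)
  from measurable_sets[OF this, of "- N"] N
  have meas: "{z \<in> space (lborel \<Otimes>\<^sub>M lborel). fst z + snd z *\<^sub>R v \<notin> N}
      \<in> sets (lborel \<Otimes>\<^sub>M (lborel :: real measure))"
    unfolding lborel_prod by (simp add: vimage_def)
  have "(AE x in lborel. negligible {t::real. x + t *\<^sub>R v \<in> N})
      \<longleftrightarrow> (AE x in lborel. AE t in lborel. x + (t::real) *\<^sub>R v \<notin> N)"
    by (simp add: borel_negligible_iff_AE[OF slice])
  also have "\<dots> \<longleftrightarrow> (AE t in lborel. AE x in lborel. x + (t::real) *\<^sub>R v \<notin> N)"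
    by (rule lborel_pair.AE_commute[OF meas])
  also have "\<dots> \<longleftrightarrow> (AE t in (lborel :: real measure). AE x in lborel. x \<notin> N)"
    by (simp add: AE_lborel_translate[OF N])
  also have "\<dots> \<longleftrightarrow> (AE x in lborel. x \<notin> N)"
    by (subst eventually_const) (simp_all add: ae_filter_eq_bot_iff)
  finally show ?thesis by (simp add: borel_negligible_iff_AE[OF N])
qed

lemma lipschitz_on_line:
  fixes f :: "'a::real_normed_vector \<Rightarrow> 'b::metric_space"
  assumes "K-lipschitz_on UNIV f"
  shows "(K * norm v)-lipschitz_on UNIV (\<lambda>t::real. f (x + t *\<^sub>R v))"
proof (rule lipschitz_onI)
  fix s t :: real
  have "dist (f (x + s *\<^sub>R v)) (f (x + t *\<^sub>R v)) \<le> K * dist (x + s *\<^sub>R v) (x + t *\<^sub>R v)"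
    by (rule lipschitz_onD[OF assms]) auto
  also have "dist (x + s *\<^sub>R v) (x + t *\<^sub>R v) = dist s t * norm v"
    by (simp add: dist_norm scaleR_left_diff_distrib[symmetric])
  finally show "dist (f (x + s *\<^sub>R v)) (f (x + t *\<^sub>R v)) \<le> K * norm v * dist s t"
    by (simp add: mult_ac)
qed (use lipschitz_on_nonneg[OF assms] in simp)

text \<open>Each line parallel to \<open>v\<close> meets the set in the oscillation set of a
  Lipschitz function of one variable, so Fubini reduces the claim to the line.\<close>

lemma negligible_quotient_oscillation:
  fixes f :: "'a::euclidean_space \<Rightarrow> real"
  assumes lip: "K-lipschitz_on UNIV f" and "p < q"
  shows "negligible (quotient_oscillation f v p q)"
proof -
  have "{t. x + t *\<^sub>R v \<in> quotient_oscillation f v p q}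
      = quotient_oscillation (\<lambda>t. f (x + t *\<^sub>R v)) 1 p q" for x
    by (simp add: quotient_oscillation_def scaleR_left_distrib add.assoc)
  moreover have "negligible (quotient_oscillation (\<lambda>t. f (x + t *\<^sub>R v)) 1 p q)" for x
    by (rule negligible_quotient_oscillation_real[OF lipschitz_on_line[OF lip] \<open>p < q\<close>])
  ultimately show ?thesis
    by (subst negligible_iff_AE_lines[of _ v])
       (auto intro!: borel_quotient_oscillation lipschitz_on_continuous_on[OF lip])
qed

section \<open>Existence of derivatives in a fixed direction\<close>

definition has_line_derivative :: "('a::real_normed_vector \<Rightarrow> real) \<Rightarrow> 'a \<Rightarrow> 'a \<Rightarrow> real \<Rightarrow> bool" where
  "has_line_derivative f x v D \<longleftrightarrow> ((\<lambda>h. (f (x + h *\<^sub>R v) - f x) / h) \<longlongrightarrow> D) (at 0)"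

lemma has_line_derivativeD:
  assumes "has_line_derivative f x v D" "0 < e"
  shows "\<forall>\<^sub>F h in at 0. \<bar>f (x + h *\<^sub>R v) - f x - h * D\<bar> \<le> e * \<bar>h\<bar>"
proof -
  have "\<forall>\<^sub>F h in at 0. \<bar>(f (x + h *\<^sub>R v) - f x) / h - D\<bar> < e"
    using tendstoD[OF assms(1)[unfolded has_line_derivative_def] assms(2)]
    by (simp add: dist_real_def)
  moreover have "\<forall>\<^sub>F h::real in at 0. h \<noteq> 0"
    by (auto simp: eventually_at_filter)
  ultimately show ?thesis
  proof eventually_elim
    case (elim h)
    have "f (x + h *\<^sub>R v) - f x - h * D = ((f (x + h *\<^sub>R v) - f x) / h - D) * h"
      using elim(2) by (simp add: field_simps)
    then have "\<bar>f (x + h *\<^sub>R v) - f x - h * D\<bar> = \<bar>(f (x + h *\<^sub>R v) - f x) / h - D\<bar> * \<bar>h\<bar>"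
      by (simp only: abs_mult)
    also have "\<dots> \<le> e * \<bar>h\<bar>" using elim(1) by (intro mult_right_mono) auto
    finally show ?case .
  qed
qed

text \<open>If the lower limit of the quotients were below the upper one, two rationals strictly
  between them would place \<open>x\<close> in an oscillation set. So the limits agree, and the
  bound \<open>K * norm v\<close> makes the common value finite.\<close>

lemma line_derivative_exists:
  fixes f :: "'a::real_normed_vector \<Rightarrow> real"
  assumes lip: "K-lipschitz_on UNIV f"
    and osc: "\<And>p q. p \<in> \<rat> \<Longrightarrow> q \<in> \<rat> \<Longrightarrow> p < q \<Longrightarrow> x \<notin> quotient_oscillation f v p q"
  shows "\<exists>D. has_line_derivative f x v D"
proof -
  define Q where "Q h = (f (x + h *\<^sub>R v) - f x) / h" for h
  let ?l = "Liminf (at 0) (\<lambda>h. ereal (Q h))" and ?u = "Limsup (at 0) (\<lambda>h. ereal (Q h))"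
  define B where "B = K * norm v"
  \<comment> \<open>At \<open>h = 0\<close> the quotient is 0 by the convention for
    division.\<close>
  have Q: "\<bar>Q h\<bar> \<le> B" for h
  proof (cases "h = 0")
    case False
    have "\<bar>f (x + h *\<^sub>R v) - f x\<bar> \<le> K * norm (h *\<^sub>R v)"
      using lipschitz_onD[OF lip, of "x + h *\<^sub>R v" x] by (simp add: dist_norm)
    with False show ?thesis by (simp add: Q_def B_def field_simps)
  qed (use lipschitz_on_nonneg[OF lip] in \<open>simp add: Q_def B_def\<close>)
  have "\<not> ?l < ?u"
  proof
    assume "?l < ?u"
    then obtain p where p: "?l < real_of_rat p" "real_of_rat p < ?u" using ereal_dense3 by blast
    obtain q where q: "real_of_rat p < ereal (real_of_rat q)" "real_of_rat q < ?u"
      using ereal_dense3[OF p(2)] by blast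
    have low: "\<exists>h. h \<noteq> 0 \<and> \<bar>h\<bar> < d \<and> Q h < real_of_rat p" if "0 < d" for d
    proof (rule ccontr)
      assume "\<not> ?thesis"
      then have "\<forall>\<^sub>F h in at 0. ereal (real_of_rat p) \<le> ereal (Q h)"
        unfolding eventually_at using that by (intro exI[of _ d]) (auto simp: dist_real_def not_less)
      from Liminf_bounded[OF this] p(1) show False by simp
    qed
    have high: "\<exists>h. h \<noteq> 0 \<and> \<bar>h\<bar> < d \<and> real_of_rat q < Q h" if "0 < d" for d
    proof (rule ccontr)
      assume "\<not> ?thesis"
      then have "\<forall>\<^sub>F h in at 0. ereal (Q h) \<le> ereal (real_of_rat q)"
        unfolding eventually_at using that by (intro exI[of _ d]) (auto simp: dist_real_def not_less)
      from Limsup_bounded[OF this] q(2) show False by simp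
    qed
    have "x \<in> quotient_oscillation f v (real_of_rat p) (real_of_rat q)"
      unfolding quotient_oscillation_def mem_Collect_eq
      using low high unfolding Q_def by simp
    moreover have "real_of_rat p < real_of_rat q" using q(1) by simp
    ultimately show False using osc[of "real_of_rat p" "real_of_rat q"] by simp
  qed
  moreover have "?l \<le> ?u" by (rule Liminf_le_Limsup) simp
  ultimately have eq: "?l = ?u" by simp
  have "ereal (- B) \<le> ?l"
    by (rule Liminf_bounded) (use Q in \<open>auto simp: abs_le_iff minus_le_iff\<close>)
  moreover have "?u \<le> ereal B"
    by (rule Limsup_bounded) (use Q in \<open>auto simp: abs_le_iff\<close>)
  ultimately obtain D where D: "?u = ereal D"
    using eq by (cases ?u) auto
  have "((\<lambda>h. ereal (Q h)) \<longlongrightarrow> ereal D) (at 0)"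
    using eq D by (subst tendsto_iff_Liminf_eq_Limsup) auto
  then show ?thesis
    unfolding has_line_derivative_def Q_def by auto
qed

lemma negligible_no_line_derivative:
  fixes f :: "'a::euclidean_space \<Rightarrow> real"
  assumes lip: "K-lipschitz_on UNIV f"
  shows "negligible {x. \<nexists>D. has_line_derivative f x v D}"
proof -
  let ?I = "{(p, q). p \<in> \<rat> \<and> q \<in> \<rat> \<and> p < (q::real)}"
  have "countable ?I"
    by (rule countable_subset[of _ "\<rat> \<times> \<rat>"]) (auto intro: countable_SIGMA countable_rat)
  then have "negligible (\<Union>(p, q)\<in>?I. quotient_oscillation f v p q)"
    by (intro negligible_countable_Union countable_image)
       (auto intro: negligible_quotient_oscillation[OF lip])
  moreover have "{x. \<nexists>D. has_line_derivative f x v D} \<subseteq> (\<Union>(p, q)\<in>?I. quotient_oscillation f v p q)"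
    using line_derivative_exists[OF lip] by fast
  ultimately show ?thesis using negligible_subset by blast
qed

text \<open>A substitute for the Lebesgue density theorem. The distance from \<^term>\<open>A\<close> is minimal on
  \<^term>\<open>A\<close>, so its derivatives along lines vanish there wherever they exist.\<close>

lemma negligible_porosity_points:
  fixes A :: "'a::euclidean_space set"
  shows "negligible {x \<in> A. \<not> (\<forall>e>0. \<exists>d>0. \<forall>h. norm h < d \<longrightarrow> infdist (x + h) A \<le> e * norm h)}"
    (is "negligible ?P")
proof -
  let ?g = "\<lambda>x. infdist x A"
  have glip: "1-lipschitz_on UNIV ?g"
    by (rule lipschitz_onI) (use infdist_triangle_abs in \<open>auto simp: dist_real_def\<close>)
  \<comment> \<open>Exceptional null sets can be united over countably many directions only, so a
    dense set \<open>Q\<close> stands in for all directions.\<close>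
  obtain Q :: "'a set" where Q: "countable Q" "\<And>X. open X \<Longrightarrow> X \<noteq> {} \<Longrightarrow> \<exists>d\<in>Q. d \<in> X"
    using countable_dense_setE by blast
  have "negligible (\<Union>v\<in>Q. {x. \<nexists>D. has_line_derivative ?g x v D})"
    by (intro negligible_countable_Union countable_image)
       (rule Q(1), erule imageE, simp only: negligible_no_line_derivative[OF glip])
  moreover have "?P \<subseteq> (\<Union>v\<in>Q. {x. \<nexists>D. has_line_derivative ?g x v D})"
  proof (rule ccontr)
    assume "\<not> ?thesis"
    then obtain x e where x: "x \<in> A" "0 < e"
      and fail: "\<not> (\<exists>d>0. \<forall>h. norm h < d \<longrightarrow> infdist (x + h) A \<le> e * norm h)"
      and "\<forall>v\<in>Q. \<exists>D. has_line_derivative ?g x v D" by blast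
    have g0: "?g x = 0" using x(1) by simp
    have zero: "has_line_derivative ?g x v 0" if "v \<in> Q" for v
    proof -
      obtain D where D: "has_line_derivative ?g x v D"
        using \<open>\<forall>v\<in>Q. _\<close> \<open>v \<in> Q\<close> by blast
      then have "((\<lambda>t. ?g (x + t *\<^sub>R v)) has_real_derivative D) (at 0)"
        by (simp add: has_line_derivative_def DERIV_def)
      then have "D = 0"
        by (rule DERIV_local_min[of _ _ _ 1]) (auto simp: g0 infdist_nonneg)
      with D show ?thesis by simp
    qed
    \<comment> \<open>By compactness finitely many directions approximate every unit vector within
      \<open>e / 2\<close>, and a single scale \<open>d\<close> serves all of them.\<close>
    have "cball 0 1 \<subseteq> (\<Union>v\<in>Q. ball v (e / 2))"
    proof
      fix u :: 'a
      obtain v where "v \<in> Q" "v \<in> ball u (e / 2)" using Q(2)[of "ball u (e / 2)"] x(2) by auto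
      then show "u \<in> (\<Union>v\<in>Q. ball v (e / 2))" by (auto simp: dist_commute)
    qed
    then obtain Q' where Q': "Q' \<subseteq> Q" "finite Q'" "cball 0 1 \<subseteq> (\<Union>v\<in>Q'. ball v (e / 2))"
      using compactE_image[of "cball 0 1 :: 'a set" Q "\<lambda>v. ball v (e / 2)"] by auto
    have "\<forall>\<^sub>F t in at 0. \<forall>v\<in>Q'. \<bar>?g (x + t *\<^sub>R v) - ?g x - t * 0\<bar> \<le> e / 2 * \<bar>t\<bar>"
      using Q'(1,2) x(2) zero by (intro eventually_ball_finite ballI has_line_derivativeD) auto
    then obtain d where "0 < d" and near: "\<forall>t. t \<noteq> 0 \<and> dist t 0 < d \<longrightarrow>
        (\<forall>v\<in>Q'. \<bar>?g (x + t *\<^sub>R v) - ?g x - t * 0\<bar> \<le> e / 2 * \<bar>t\<bar>)"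
      unfolding eventually_at by blast
    have d: "?g (x + t *\<^sub>R v) \<le> e / 2 * \<bar>t\<bar>" if "t \<noteq> 0" "\<bar>t\<bar> < d" "v \<in> Q'" for t v
      using near that by (simp add: dist_real_def g0 infdist_nonneg abs_of_nonneg)
    have "?g (x + h) \<le> e * norm h" if "norm h < d" for h
    proof (cases "h = 0")
      case False
      define u where "u = h /\<^sub>R norm h"
      have u: "h = norm h *\<^sub>R u" "u \<in> cball 0 1" using False by (auto simp: u_def)
      then obtain v where v: "v \<in> Q'" "dist v u < e / 2" using Q'(3) by auto
      \<comment> \<open>The distance function is 1-Lipschitz: replacing the direction
        \<open>u\<close> by \<open>v\<close> costs at most \<open>e / 2 * norm h\<close>, and the
        derivative 0 along \<open>v\<close> costs as much again.\<close>
      have "?g (x + h) \<le> ?g (x + norm h *\<^sub>R v) + dist (x + h) (x + norm h *\<^sub>R v)"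
        by (rule infdist_triangle)
      also have "?g (x + norm h *\<^sub>R v) \<le> e / 2 * norm h"
        using d[of "norm h" v] False v(1) that by simp
      also have "dist (x + h) (x + norm h *\<^sub>R v) = norm h * dist v u"
        by (subst u(1)) (simp add: dist_norm scaleR_right_diff_distrib[symmetric] norm_minus_commute)
      also have "\<dots> \<le> norm h * (e / 2)"
        using v(2) by (intro mult_left_mono) auto
      finally show ?thesis by (simp add: field_simps)
    qed (simp add: g0)
    with \<open>0 < d\<close> fail show False by blast
  qed
  ultimately show ?thesis using negligible_subset by blast
qed

section \<open>Rademacher's theorem\<close>

text \<open>Walk from \<open>x\<close> to \<open>x + h\<close> by coordinate steps. Each corner
  \<open>z\<close> lies within \<open>2 * \<eta> * norm h\<close> of some \<open>y\<close> in
  \<open>A\<close>, where the step estimate is available. Moving both ends of the step from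
  \<open>z\<close> to \<open>y\<close> costs \<open>4 * K * \<eta> * norm h\<close>, which explains
  the factor \<open>1 + 4 * K\<close> per coordinate.\<close>

lemma increment_near_linear:
  fixes f :: "'a::euclidean_space \<Rightarrow> real"
  assumes lip: "K-lipschitz_on UNIV f" and A: "A \<noteq> {}" and \<eta>: "0 < \<eta>"
    and step: "\<And>y b t. y \<in> A \<Longrightarrow> b \<in> Basis \<Longrightarrow> \<bar>t\<bar> < d \<Longrightarrow>
      \<bar>f (y + t *\<^sub>R b) - f y - t * (p \<bullet> b)\<bar> \<le> \<eta> * \<bar>t\<bar>"
    and near: "\<And>h. norm h < d \<Longrightarrow> infdist (x + h) A \<le> \<eta> * norm h"
    and h: "norm h < d"
  shows "\<bar>f (x + h) - f x - p \<bullet> h\<bar> \<le> DIM('a) * ((1 + 4 * K) * \<eta> * norm h)"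
proof (cases "h = 0")
  case False
  have K: "0 \<le> K" using lip lipschitz_on_nonneg by blast
  have lip': "\<bar>f y - f z\<bar> \<le> K * norm (y - z)" for y z
    using lipschitz_onD[OF lip, of y z] by (simp add: dist_norm)
  define hs where "hs S = (\<Sum>b\<in>S. (h \<bullet> b) *\<^sub>R b)" for S :: "'a set"
  define E where "E = (1 + 4 * K) * \<eta> * norm h"
  have norm_hs: "norm (hs S) \<le> norm h" if S: "S \<subseteq> Basis" for S
  proof -
    have "finite S" by (rule finite_subset[OF S finite_Basis])
    have "hs S \<bullet> b = (if b \<in> S then h \<bullet> b else 0)" if "b \<in> Basis" for b
    proof -
      have "hs S \<bullet> b = (\<Sum>c\<in>S. (h \<bullet> c) * (c \<bullet> b))" by (simp add: hs_def inner_sum_left)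
      also have "\<dots> = (\<Sum>c\<in>S. if c = b then h \<bullet> b else 0)"
        using S that by (intro sum.cong) (auto simp: inner_Basis)
      finally show ?thesis using \<open>finite S\<close> by simp
    qed
    then have "\<bar>hs S \<bullet> b\<bar> \<le> \<bar>h \<bullet> b\<bar>" if "b \<in> Basis" for b using that by simp
    then show ?thesis by (rule norm_le_componentwise)
  qed
  have "\<bar>f (x + hs S) - f x - p \<bullet> hs S\<bar> \<le> card S * E" if "finite S" "S \<subseteq> Basis" for S
    using that
  proof (induction S)
    case empty
    then show ?case by (simp add: hs_def)
  next
    case (insert b S)
    define z where "z = x + hs S"
    define t where "t = h \<bullet> b"
    have b: "b \<in> Basis" and S: "S \<subseteq> Basis" using insert.prems by auto
    have t: "\<bar>t\<bar> \<le> norm h" using b by (simp add: t_def Basis_le_norm)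
    have hs': "hs (insert b S) = hs S + t *\<^sub>R b"
      using insert.hyps by (simp add: hs_def t_def add.commute)
    have "infdist z A \<le> \<eta> * norm h"
    proof -
      have "infdist z A \<le> \<eta> * norm (hs S)"
        unfolding z_def using near norm_hs[OF S] h by auto
      also have "\<dots> \<le> \<eta> * norm h" using norm_hs[OF S] \<eta> by simp
      finally show ?thesis .
    qed
    \<comment> \<open>The infimum need not be attained; doubling the bound yields an actual point of
      \<open>A\<close>.\<close>
    also have "\<dots> < 2 * \<eta> * norm h" using \<eta> False by simp
    finally obtain y where y: "y \<in> A" "dist z y < 2 * \<eta> * norm h"
      using A by (auto simp: infdist_notempty cINF_less_iff)
    have yz: "\<bar>f (z + w) - f (y + w)\<bar> \<le> 2 * K * \<eta> * norm h" for w
    proof -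
      have "\<bar>f (z + w) - f (y + w)\<bar> \<le> K * dist z y"
        using lip'[of "z + w" "y + w"] by (simp add: dist_norm)
      also have "\<dots> \<le> K * (2 * \<eta> * norm h)" using y(2) K by (intro mult_left_mono) auto
      finally show ?thesis by (simp add: mult_ac)
    qed
    have "\<bar>f (y + t *\<^sub>R b) - f y - t * (p \<bullet> b)\<bar> \<le> \<eta> * \<bar>t\<bar>"
      using step[OF y(1) b] t h by simp
    also have "\<dots> \<le> \<eta> * norm h" using t \<eta> by simp
    finally have "\<bar>f (y + t *\<^sub>R b) - f y - t * (p \<bullet> b)\<bar> \<le> \<eta> * norm h" .
    moreover have "E = \<eta> * norm h + 2 * (2 * K * \<eta> * norm h)"
      by (simp add: E_def algebra_simps)
    ultimately have "\<bar>f (z + t *\<^sub>R b) - f z - t * (p \<bullet> b)\<bar> \<le> E"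
      using yz[of "t *\<^sub>R b"] yz[of 0] unfolding add_0_right by linarith
    moreover have "f (x + hs (insert b S)) - f x - p \<bullet> hs (insert b S)
        = (f (z + t *\<^sub>R b) - f z - t * (p \<bullet> b)) + (f (x + hs S) - f x - p \<bullet> hs S)"
      by (simp add: hs' z_def inner_add_right add.assoc)
    ultimately have "\<bar>f (x + hs (insert b S)) - f x - p \<bullet> hs (insert b S)\<bar> \<le> E + card S * E"
      using insert.IH[OF S] by linarith
    then show ?case using insert.hyps by (simp add: algebra_simps)
  qed
  from this[of Basis] show ?thesis
    by (simp add: hs_def euclidean_representation E_def)
qed simp

lemma rademacher_real:
  fixes f :: "'a::euclidean_space \<Rightarrow> real"
  assumes lip: "K-lipschitz_on UNIV f"
  shows "negligible {x. \<not> f differentiable (at x)}"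
proof -
  have K: "0 \<le> K" using lip lipschitz_on_nonneg by blast
  \<comment> \<open>Here \<open>p\<close> approximates the gradient, \<open>k\<close> measures the
    accuracy and \<open>m\<close> the scale. Taking \<open>p\<close> from a countable dense set
    keeps the family countable.\<close>
  define A where "A p k m = {x. \<forall>b\<in>Basis. \<forall>t. \<bar>t\<bar> < inverse (real (Suc m)) \<longrightarrow>
      \<bar>f (x + t *\<^sub>R b) - f x - t * (p \<bullet> b)\<bar> \<le> inverse (real (Suc k)) * \<bar>t\<bar>}" for p :: 'a and k m
  define P where "P A = {x \<in> A. \<not> (\<forall>e>0. \<exists>d>0. \<forall>h. norm h < d \<longrightarrow> infdist (x + h) A \<le> e * norm h)}"
    for A :: "'a set"
  obtain Q :: "'a set" where Q: "countable Q" "\<And>X. open X \<Longrightarrow> X \<noteq> {} \<Longrightarrow> \<exists>d\<in>Q. d \<in> X"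
    using countable_dense_setE by blast
  define B where "B = (\<Union>b\<in>Basis. {x. \<nexists>D. has_line_derivative f x b D}) \<union> (\<Union>p\<in>Q. \<Union>k. \<Union>m. P (A p k m))"
  have "negligible (P A)" for A
    unfolding P_def by (rule negligible_porosity_points)
  then have "negligible (\<Union>m. P (A p k m))" for p k
    by (intro negligible_countable_Union) auto
  then have "negligible (\<Union>k. \<Union>m. P (A p k m))" for p
    by (intro negligible_countable_Union) auto
  then have "negligible (\<Union>p\<in>Q. \<Union>k. \<Union>m. P (A p k m))"
    by (intro negligible_countable_Union countable_image Q(1)) auto
  moreover have "negligible (\<Union>b\<in>(Basis :: 'a set). {x. \<nexists>D. has_line_derivative f x b D})"
    by (intro negligible_Union finite_imageI)
       (simp, erule imageE, simp only: negligible_no_line_derivative[OF lip])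
  ultimately have "negligible B" unfolding B_def by (intro negligible_Un)
  moreover have "{x. \<not> f differentiable (at x)} \<subseteq> B"
  proof (rule ccontr)
    assume "\<not> ?thesis"
    then obtain x where nd: "\<not> f differentiable (at x)" and "x \<notin> B" by blast
    then have "\<forall>b\<in>Basis. \<exists>D. has_line_derivative f x b D"
      and dens: "\<And>p k m. p \<in> Q \<Longrightarrow> x \<notin> P (A p k m)"
      by (simp_all add: B_def)
    from this(1) obtain D where D: "\<And>b. b \<in> Basis \<Longrightarrow> has_line_derivative f x b (D b)" by metis
    define p0 where "p0 = (\<Sum>b\<in>Basis. D b *\<^sub>R b)"
    have p0: "p0 \<bullet> b = D b" if "b \<in> Basis" for b
      using that by (simp add: p0_def)
    \<comment> \<open>The coordinate steps contribute \<open>DIM('a) * (1 + 4 * K)\<close>, and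
      replacing \<open>p\<close> by the gradient candidate \<open>p0\<close> contributes the final
      1.\<close>
    define c where "c = DIM('a) * (1 + 4 * K) + 1"
    have c: "1 \<le> c" using K by (simp add: c_def)
    have "\<exists>d>0. \<forall>y. norm (y - x) < d \<longrightarrow> norm (f y - f x - p0 \<bullet> (y - x)) \<le> e * norm (y - x)"
      if "0 < e" for e
    proof -
      have "0 < e / c" using that c by simp
      then obtain k where k: "inverse (real (Suc k)) < e / c" using reals_Archimedean by blast
      define \<eta> where "\<eta> = inverse (real (Suc k))"
      have \<eta>: "0 < \<eta>" "c * \<eta> \<le> e" using k c by (auto simp: \<eta>_def field_simps)
      \<comment> \<open>Half of \<open>\<eta>\<close> is spent on the distance from
        \<open>p0\<close> to \<open>p\<close>, the other half on the convergence of the quotients at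
        \<open>x\<close>.\<close>
      obtain p where p: "p \<in> Q" "dist p0 p < \<eta> / 2"
        using Q(2)[of "ball p0 (\<eta> / 2)"] \<eta>(1) by auto
      have "\<forall>\<^sub>F t in at 0. \<forall>b\<in>Basis. \<bar>f (x + t *\<^sub>R b) - f x - t * D b\<bar> \<le> \<eta> / 2 * \<bar>t\<bar>"
        using \<eta>(1) D by (intro eventually_ball_finite ballI has_line_derivativeD) auto
      then obtain d1 where "0 < d1" and d1: "\<forall>t. t \<noteq> 0 \<and> dist t 0 < d1 \<longrightarrow>
          (\<forall>b\<in>Basis. \<bar>f (x + t *\<^sub>R b) - f x - t * D b\<bar> \<le> \<eta> / 2 * \<bar>t\<bar>)"
        unfolding eventually_at by blast
      obtain m where m: "inverse (real (Suc m)) < d1" using reals_Archimedean[OF \<open>0 < d1\<close>] by blast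
      have "x \<in> A p k m"
        unfolding A_def mem_Collect_eq \<eta>_def[symmetric]
      proof (intro ballI allI impI)
        fix b :: 'a and t :: real
        assume b: "b \<in> Basis" and t: "\<bar>t\<bar> < inverse (real (Suc m))"
        show "\<bar>f (x + t *\<^sub>R b) - f x - t * (p \<bullet> b)\<bar> \<le> \<eta> * \<bar>t\<bar>"
        proof (cases "t = 0")
          case False
          have "\<bar>D b - p \<bullet> b\<bar> \<le> \<eta> / 2"
            using Basis_le_norm[OF b, of "p0 - p"] p(2) p0[OF b] by (simp add: inner_diff_left dist_norm)
          then have "\<bar>t * (D b - p \<bullet> b)\<bar> \<le> \<eta> / 2 * \<bar>t\<bar>"
            unfolding abs_mult by (subst mult.commute) (rule mult_right_mono, simp_all)
          moreover have "\<bar>f (x + t *\<^sub>R b) - f x - t * D b\<bar> \<le> \<eta> / 2 * \<bar>t\<bar>"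
            using d1 False t m b by simp
          moreover have "\<bar>f (x + t *\<^sub>R b) - f x - t * (p \<bullet> b)\<bar>
              \<le> \<bar>f (x + t *\<^sub>R b) - f x - t * D b\<bar> + \<bar>t * (D b - p \<bullet> b)\<bar>"
            by (rule order_trans[OF _ abs_triangle_ineq]) (simp add: right_diff_distrib)
          ultimately show ?thesis by simp
        qed simp
      qed
      moreover have "x \<notin> P (A p k m)" using dens p(1) by blast
      ultimately obtain d2 where d2: "0 < d2"
        "\<And>h. norm h < d2 \<Longrightarrow> infdist (x + h) (A p k m) \<le> \<eta> * norm h"
        unfolding P_def using \<eta>(1) by blast
      define d where "d = min d2 (inverse (real (Suc m)))"
      have "0 < d" using d2(1) by (simp add: d_def)
      moreover have "norm (f y - f x - p0 \<bullet> (y - x)) \<le> e * norm (y - x)" if "norm (y - x) < d" for y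
      proof -
        define h where "h = y - x"
        have "\<bar>f (x + h) - f x - p \<bullet> h\<bar> \<le> DIM('a) * ((1 + 4 * K) * \<eta> * norm h)"
        proof (rule increment_near_linear[OF lip, of "A p k m" _ d])
          show "\<bar>f (z + t *\<^sub>R b) - f z - t * (p \<bullet> b)\<bar> \<le> \<eta> * \<bar>t\<bar>"
            if "z \<in> A p k m" "b \<in> Basis" "\<bar>t\<bar> < d" for z b t
            using that unfolding A_def \<eta>_def d_def by simp
          show "A p k m \<noteq> {}" using \<open>x \<in> A p k m\<close> by blast
          show "infdist (x + h) (A p k m) \<le> \<eta> * norm h" if "norm h < d" for h
            using d2(2) that by (simp add: d_def)
          show "norm h < d" using that by (simp add: h_def)
        qed (rule \<eta>(1))
        moreover have "\<bar>p \<bullet> h - p0 \<bullet> h\<bar> \<le> \<eta> * norm h"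
        proof -
          have "\<bar>(p - p0) \<bullet> h\<bar> \<le> norm (p - p0) * norm h" by (rule Cauchy_Schwarz_ineq2)
          also have "\<dots> \<le> \<eta> * norm h"
            using p(2) \<eta>(1) by (intro mult_right_mono) (auto simp: dist_norm norm_minus_commute)
          finally show ?thesis by (simp add: inner_diff_left)
        qed
        moreover have "c * \<eta> * norm h = DIM('a) * ((1 + 4 * K) * \<eta> * norm h) + \<eta> * norm h"
          by (simp add: c_def algebra_simps)
        ultimately have "\<bar>f (x + h) - f x - p0 \<bullet> h\<bar> \<le> c * \<eta> * norm h"
          by linarith
        also have "\<dots> \<le> e * norm h" using \<eta>(2) by (intro mult_right_mono) auto
        finally show ?thesis by (simp add: h_def)
      qed
      ultimately show ?thesis by blast
    qed
    then have "(f has_derivative (\<lambda>h. p0 \<bullet> h)) (at x)"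
      by (simp add: has_derivative_at_alt bounded_linear_inner_right)
    with nd show False by (auto simp: differentiable_def)
  qed
  ultimately show ?thesis using negligible_subset by blast
qed

lemma rademacher:
  fixes f :: "'a::euclidean_space \<Rightarrow> 'b::euclidean_space"
  assumes lip: "K-lipschitz_on UNIV f"
  shows "negligible {x. \<not> f differentiable (at x)}"
proof -
  have "K-lipschitz_on UNIV (\<lambda>x. f x \<bullet> b)" if "b \<in> Basis" for b
  proof (rule lipschitz_onI)
    fix x y
    have "\<bar>(f x - f y) \<bullet> b\<bar> \<le> norm (f x - f y)" using that by (rule Basis_le_norm)
    also have "\<dots> \<le> K * dist x y" using lipschitz_onD[OF lip, of x y] by (simp add: dist_norm)
    finally show "dist (f x \<bullet> b) (f y \<bullet> b) \<le> K * dist x y"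
      by (simp add: dist_real_def inner_diff_left)
  qed (use lipschitz_on_nonneg[OF lip] in simp)
  then have "negligible (\<Union>b\<in>Basis. {x. \<not> (\<lambda>x. f x \<bullet> b) differentiable (at x)})"
    by (intro negligible_Union finite_imageI) (auto intro!: rademacher_real)
  moreover have "{x. \<not> f differentiable (at x)}
      \<subseteq> (\<Union>b\<in>Basis. {x. \<not> (\<lambda>x. f x \<bullet> b) differentiable (at x)})"
    using differentiable_componentwise_within[of f _ UNIV] by blast
  ultimately show ?thesis using negligible_subset by blast
qed

section \<open>Generalized Jacobians\<close>

lemma continuous_on_matrix_vector_mult [continuous_intros]:
  fixes M :: "'a::topological_space \<Rightarrow> real^'n^'m"
  assumes "continuous_on S M" "continuous_on S v"
  shows "continuous_on S (\<lambda>x. M x *v v x)"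
  unfolding matrix_vector_mult_def
  by (intro continuous_on_vec_lambda continuous_on_sum continuous_on_mult
      continuous_on_component assms)

text \<open>Compare the increment of \<open>f\<close> along a short multiple
  \<open>s *\<^sub>R h\<close> with its linear approximation and divide by \<open>s\<close>.\<close>

lemma jacobian_vector_norm_le:
  fixes f :: "real^'n \<Rightarrow> real^'m"
  assumes lip: "K-lipschitz_on UNIV f" and diff: "f differentiable (at y)"
  shows "norm (jacobian f (at y) *v h) \<le> K * norm h"
proof (rule field_le_epsilon)
  let ?J = "jacobian f (at y)"
  fix e :: real assume "0 < e"
  define n where "n = norm h + 1"
  have n: "0 < n" "norm h \<le> n" by (simp_all add: n_def add_nonneg_pos)
  define e' where "e' = e / n"
  have e': "0 < e'" using \<open>0 < e\<close> n by (simp add: e'_def)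
  have "(f has_derivative (\<lambda>h. ?J *v h)) (at y)"
    using diff by (simp add: jacobian_works)
  then obtain d where d: "0 < d"
    "\<And>z. norm (z - y) < d \<Longrightarrow> norm (f z - f y - ?J *v (z - y)) \<le> e' * norm (z - y)"
    using e' unfolding has_derivative_at_alt by blast
  \<comment> \<open>Since \<open>n\<close> is positive and at least \<open>norm h\<close>, the
    vector \<open>s *\<^sub>R h\<close> has length at most \<open>d / 2\<close>, also when
    \<open>h = 0\<close>.\<close>
  define s where "s = d / (2 * n)"
  have s: "0 < s" using d(1) n by (simp add: s_def)
  have "s * norm h \<le> s * n" using s n by simp
  also have "\<dots> = d / 2"
    using n by (simp add: s_def)
  also have "\<dots> < d" using d(1) by simp
  finally have sh: "norm (s *\<^sub>R h) < d" using s by simp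
  have "norm (f (y + s *\<^sub>R h) - f y - ?J *v (s *\<^sub>R h)) \<le> e' * (s * norm h)"
    using d(2)[of "y + s *\<^sub>R h"] sh s by simp
  moreover have "norm (f (y + s *\<^sub>R h) - f y) \<le> K * (s * norm h)"
    using lipschitz_onD[OF lip, of "y + s *\<^sub>R h" y] s by (simp add: dist_norm)
  moreover have "norm (?J *v (s *\<^sub>R h)) = s * norm (?J *v h)"
    using s by (simp add: matrix_vector_mult_scaleR)
  ultimately have "s * norm (?J *v h) \<le> K * (s * norm h) + e' * (s * norm h)"
    using norm_triangle_ineq4[of "f (y + s *\<^sub>R h) - f y" "f (y + s *\<^sub>R h) - f y - ?J *v (s *\<^sub>R h)"]
    by simp
  also have "\<dots> = s * (K * norm h + e' * norm h)" by (simp add: algebra_simps)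
  finally have "norm (?J *v h) \<le> K * norm h + e' * norm h" using s by simp
  also have "e' * norm h \<le> e' * n" using e' n by simp
  also have "\<dots> = e" using n by (simp add: e'_def)
  finally show "norm (?J *v h) \<le> K * norm h + e" by simp
qed

text \<open>Converts a bound in the sense of the operator norm into one for the Frobenius norm of
  the type: testing on basis vectors bounds every entry by \<open>K\<close>.\<close>

lemma matrix_norm_le_of_vector_bound:
  fixes M :: "real^'n^'m"
  assumes "\<And>h. norm (M *v h) \<le> K * norm h"
  shows "norm M \<le> real CARD('m) * (real CARD('n) * K)"
proof -
  have comp: "\<bar>M $ i $ j\<bar> \<le> K" for i j
  proof -
    have "\<bar>(M *v axis j 1) $ i\<bar> \<le> norm (M *v axis j 1)" by (rule component_le_norm_cart)
    also have "\<dots> \<le> K" using assms[of "axis j 1"] by simp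
    finally show ?thesis by (simp add: matrix_vector_mult_basis column_def)
  qed
  have "norm M \<le> (\<Sum>i\<in>UNIV. norm (M $ i))"
    unfolding norm_vec_def by (rule L2_set_le_sum) simp
  also have "\<dots> \<le> (\<Sum>i\<in>(UNIV::'m set). real CARD('n) * K)"
  proof (rule sum_mono)
    fix i
    have "norm (M $ i) \<le> (\<Sum>j\<in>UNIV. \<bar>M $ i $ j\<bar>)" by (rule norm_le_l1_cart)
    also have "\<dots> \<le> (\<Sum>j\<in>(UNIV::'n set). K)" by (intro sum_mono comp)
    finally show "norm (M $ i) \<le> real CARD('n) * K" by simp
  qed
  finally show ?thesis by simp
qed

text \<open>The limits of Jacobians, described by approximation instead of sequences; closedness
  then follows by halving \<open>e\<close>.\<close>

definition jacobian_limits :: "(real^'n \<Rightarrow> real^'m) \<Rightarrow> real^'n \<Rightarrow> (real^'n^'m) set" where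
  "jacobian_limits f x = {M. \<forall>e>0. \<exists>y. dist y x < e \<and> f differentiable (at y) \<and> dist (jacobian f (at y)) M < e}"

lemma generalized_jacobian_eq_hull:
  "generalized_jacobian f x = convex hull jacobian_limits f x"
proof -
  have "(\<exists>X. X \<longlonglongrightarrow> x \<and> (\<forall>i. f differentiable (at (X i))) \<and> (\<lambda>i. jacobian f (at (X i))) \<longlonglongrightarrow> M)
      \<longleftrightarrow> M \<in> jacobian_limits f x" for M
  proof
    assume "\<exists>X. X \<longlonglongrightarrow> x \<and> (\<forall>i. f differentiable (at (X i))) \<and> (\<lambda>i. jacobian f (at (X i))) \<longlonglongrightarrow> M"
    then obtain X where X: "X \<longlonglongrightarrow> x" "\<And>i. f differentiable (at (X i))"
      "(\<lambda>i. jacobian f (at (X i))) \<longlonglongrightarrow> M" by blast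
    show "M \<in> jacobian_limits f x"
      unfolding jacobian_limits_def mem_Collect_eq
    proof (intro allI impI)
      fix e :: real assume "0 < e"
      have "\<forall>\<^sub>F i in sequentially. dist (X i) x < e \<and> dist (jacobian f (at (X i))) M < e"
        using tendstoD[OF X(1) \<open>0 < e\<close>] tendstoD[OF X(3) \<open>0 < e\<close>] by (rule eventually_conj)
      then obtain i where "dist (X i) x < e \<and> dist (jacobian f (at (X i))) M < e"
        using eventually_happens' sequentially_bot by blast
      with X(2) show "\<exists>y. dist y x < e \<and> f differentiable (at y) \<and> dist (jacobian f (at y)) M < e"
        by blast
    qed
  next
    assume "M \<in> jacobian_limits f x"
    then have "\<forall>i. \<exists>y. dist y x < inverse (real (Suc i)) \<and> f differentiable (at y)
        \<and> dist (jacobian f (at y)) M < inverse (real (Suc i))"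
      unfolding jacobian_limits_def by simp
    then obtain X where X: "\<And>i. dist (X i) x < inverse (real (Suc i))"
      "\<And>i. f differentiable (at (X i))"
      "\<And>i. dist (jacobian f (at (X i))) M < inverse (real (Suc i))" by metis
    have "X \<longlonglongrightarrow> x"
      by (rule metric_tendsto_imp_tendsto[OF LIMSEQ_inverse_real_of_nat])
         (use X(1) in \<open>auto intro!: always_eventually less_imp_le\<close>)
    moreover have "(\<lambda>i. jacobian f (at (X i))) \<longlonglongrightarrow> M"
      by (rule metric_tendsto_imp_tendsto[OF LIMSEQ_inverse_real_of_nat])
         (use X(3) in \<open>auto intro!: always_eventually less_imp_le\<close>)
    ultimately show "\<exists>X. X \<longlonglongrightarrow> x \<and> (\<forall>i. f differentiable (at (X i))) \<and> (\<lambda>i. jacobian f (at (X i))) \<longlonglongrightarrow> M"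
      using X(2) by blast
  qed
  then show ?thesis by (simp only: generalized_jacobian_def Collect_mem_eq)
qed

text \<open>The point \<open>x\<close> approximates itself, so continuity of the derivative is not
  involved. Through this fact, inclusions between generalized Jacobians give information on the
  Jacobians themselves.\<close>

lemma jacobian_in_generalized_jacobian:
  assumes "f differentiable (at x)"
  shows "jacobian f (at x) \<in> generalized_jacobian f x"
proof -
  have "jacobian f (at x) \<in> jacobian_limits f x"
    unfolding jacobian_limits_def mem_Collect_eq
    by (intro allI impI exI[of _ x]) (simp add: assms)
  then show ?thesis unfolding generalized_jacobian_eq_hull by (rule hull_inc)
qed

text \<open>The limit set is closed, and the Lipschitz constant bounds it; in finite dimension the
  convex hull of a compact set is compact.\<close>

lemma compact_generalized_jacobian:
  fixes f :: "real^'n \<Rightarrow> real^'m"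
  assumes lip: "K-lipschitz_on UNIV f"
  shows "compact (generalized_jacobian f x)"
proof -
  have "closed (jacobian_limits f x)"
    unfolding closure_subset_eq[symmetric]
  proof
    fix M assume "M \<in> closure (jacobian_limits f x)"
    then have M: "\<forall>e>0. \<exists>M'\<in>jacobian_limits f x. dist M' M < e"
      by (simp only: closure_approachable)
    show "M \<in> jacobian_limits f x"
      unfolding jacobian_limits_def mem_Collect_eq
    proof (intro allI impI)
      fix e :: real assume "0 < e"
      then have "0 < e / 2" by simp
      then obtain M' where M': "M' \<in> jacobian_limits f x" "dist M' M < e / 2" using M by blast
      obtain y where y: "dist y x < e / 2" "f differentiable (at y)" "dist (jacobian f (at y)) M' < e / 2"
        using M'(1) \<open>0 < e / 2\<close> unfolding jacobian_limits_def by blast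
      moreover have "dist (jacobian f (at y)) M < e"
        using dist_triangle[of "jacobian f (at y)" M M'] y(3) M'(2) by linarith
      ultimately show "\<exists>y. dist y x < e \<and> f differentiable (at y) \<and> dist (jacobian f (at y)) M < e"
        using \<open>0 < e\<close> by (intro exI[of _ y]) auto
    qed
  qed
  moreover have "bounded (jacobian_limits f x)"
  proof (rule boundedI)
    fix M assume "M \<in> jacobian_limits f x"
    from this[unfolded jacobian_limits_def mem_Collect_eq, rule_format, OF zero_less_one]
    obtain y where y: "f differentiable (at y)" "dist (jacobian f (at y)) M < 1" by blast
    have "norm (jacobian f (at y)) \<le> real CARD('m) * (real CARD('n) * K)"
      by (intro matrix_norm_le_of_vector_bound jacobian_vector_norm_le[OF lip y(1)])
    with y(2) show "norm M \<le> real CARD('m) * (real CARD('n) * K) + 1"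
      using norm_triangle_sub[of M "jacobian f (at y)"] by (simp add: dist_norm norm_minus_commute)
  qed
  ultimately show ?thesis
    unfolding generalized_jacobian_eq_hull by (intro compact_convex_hull) (simp add: compact_eq_bounded_closed)
qed

text \<open>Rademacher's theorem supplies differentiability points converging to \<open>x\<close>;
  the Jacobians there are bounded, so a subsequence converges.\<close>

lemma generalized_jacobian_nonempty:
  fixes f :: "real^'n \<Rightarrow> real^'m"
  assumes lip: "K-lipschitz_on UNIV f"
  shows "generalized_jacobian f x \<noteq> {}"
proof -
  have "\<exists>y. dist y x < inverse (real (Suc i)) \<and> f differentiable (at y)" for i
  proof (rule ccontr)
    assume "\<not> ?thesis"
    then have "ball x (inverse (real (Suc i))) \<subseteq> {y. \<not> f differentiable (at y)}"
      by (auto simp: dist_commute)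
    then have "negligible (ball x (inverse (real (Suc i))))"
      using rademacher[OF lip] negligible_subset by blast
    then show False
      using open_not_negligible[of "ball x (inverse (real (Suc i)))"] by simp
  qed
  then obtain Y where Y: "\<And>i. dist (Y i) x < inverse (real (Suc i))" "\<And>i. f differentiable (at (Y i))"
    by metis
  have "Y \<longlonglongrightarrow> x"
    by (rule metric_tendsto_imp_tendsto[OF LIMSEQ_inverse_real_of_nat])
       (use Y(1) in \<open>auto intro!: always_eventually less_imp_le\<close>)
  have "norm (jacobian f (at (Y i))) \<le> real CARD('m) * (real CARD('n) * K)" for i
    by (intro matrix_norm_le_of_vector_bound jacobian_vector_norm_le[OF lip Y(2)])
  then have "bounded (range (\<lambda>i. jacobian f (at (Y i))))"
    by (intro boundedI) (erule rangeE, hypsubst)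
  then obtain M \<sigma> where "strict_mono \<sigma>" "((\<lambda>i. jacobian f (at (Y i))) \<circ> \<sigma>) \<longlonglongrightarrow> M"
    using bounded_imp_convergent_subsequence by blast
  then have "M \<in> {M. \<exists>X. X \<longlonglongrightarrow> x \<and> (\<forall>i. f differentiable (at (X i)))
      \<and> (\<lambda>i. jacobian f (at (X i))) \<longlonglongrightarrow> M}"
    using LIMSEQ_subseq_LIMSEQ[OF \<open>Y \<longlonglongrightarrow> x\<close>] Y(2)
    by (intro CollectI exI[of _ "Y \<circ> \<sigma>"]) (simp add: o_def)
  from hull_inc[OF this, of convex] show ?thesis
    unfolding generalized_jacobian_def by (intro notI) (simp only: empty_iff)
qed

section \<open>Uniform lower bounds for compact sets of invertible matrices\<close>

lemma norm_mult_vector_le_op_norm: "norm (A *v u) \<le> op_norm A * norm u"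
  unfolding op_norm_def by (rule onorm) simp

lemma matrix_inv_mult_vector:
  fixes M :: "real^'n^'n"
  assumes "invertible M"
  shows "matrix_inv M *v (M *v u) = u" "M *v (matrix_inv M *v u) = u"
proof -
  have "M ** matrix_inv M = mat 1 \<and> matrix_inv M ** M = mat 1"
    using assms unfolding invertible_def matrix_inv_def by (rule someI_ex)
  then show "matrix_inv M *v (M *v u) = u" "M *v (matrix_inv M *v u) = u"
    by (simp_all add: matrix_vector_mul_assoc)
qed

lemma op_norm_matrix_inv_pos:
  fixes M :: "real^'n^'n"
  assumes "invertible M"
  shows "0 < op_norm (matrix_inv M)"
proof -
  obtain u :: "real^'n" where "u \<noteq> 0" using vector_choose_size[of 1] by fastforce
  then have "matrix_inv M *v (M *v u) \<noteq> 0" by (simp add: matrix_inv_mult_vector[OF assms])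
  then show ?thesis unfolding op_norm_def by (subst onorm_pos_lt) auto
qed

text \<open>The norm of \<open>M *v u\<close> attains its minimum over matrices in \<open>S\<close>
  and unit vectors, and invertibility keeps it away from 0.\<close>

lemma compact_invertible_lower_bound:
  fixes S :: "(real^'n^'n) set"
  assumes "compact S" "S \<noteq> {}" and inv: "\<And>M. M \<in> S \<Longrightarrow> invertible M"
  obtains c where "0 < c" "\<And>M u. M \<in> S \<Longrightarrow> c * norm u \<le> norm (M *v u)"
proof -
  let ?T = "S \<times> sphere (0 :: real^'n) 1"
  have "?T \<noteq> {}" using assms(2) by auto
  moreover have "compact ?T" using assms(1) by (intro compact_Times) auto
  moreover have "continuous_on ?T (\<lambda>z. norm (fst z *v snd z))" by (intro continuous_intros)
  ultimately obtain z where z: "z \<in> ?T" "\<And>y. y \<in> ?T \<Longrightarrow> norm (fst z *v snd z) \<le> norm (fst y *v snd y)"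
    using continuous_attains_inf[of ?T "\<lambda>z. norm (fst z *v snd z)"] by blast
  define c where "c = norm (fst z *v snd z)"
  have "snd z \<noteq> 0" "invertible (fst z)" using z(1) inv by auto
  then have "fst z *v snd z \<noteq> 0" by (metis matrix_inv_mult_vector(1) matrix_vector_mult_0_right)
  then have "0 < c" by (simp add: c_def)
  moreover have "c * norm u \<le> norm (M *v u)" if "M \<in> S" for M u
  proof (cases "u = 0")
    case False
    have "c \<le> norm (M *v (u /\<^sub>R norm u))"
      unfolding c_def using z(2)[of "(M, u /\<^sub>R norm u)"] that False by simp
    with False show ?thesis by (simp add: matrix_vector_mult_scaleR field_simps)
  qed simp
  ultimately show thesis by (rule that)
qed

text \<open>The number \<open>1 / op_norm (matrix_inv M)\<close> is the best constant in a lower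
  bound for the norm of \<open>M *v u\<close> by that of \<open>u\<close>. The uniform constant
  \<open>c\<close> from compactness thus lies below all these numbers, which makes the infimum both
  meaningful and positive.\<close>

lemma infimum_inverse_norm:
  fixes S :: "(real^'n^'n) set"
  assumes S: "compact S" "S \<noteq> {}" and inv: "\<And>M. M \<in> S \<Longrightarrow> invertible M"
  defines "m \<equiv> INF M\<in>S. 1 / op_norm (matrix_inv M)"
  shows "0 < m" and "M \<in> S \<Longrightarrow> m * norm u \<le> norm (M *v u)"
proof -
  obtain c where c: "0 < c" "\<And>M u. M \<in> S \<Longrightarrow> c * norm u \<le> norm (M *v u)"
    using compact_invertible_lower_bound[OF assms(1-3)] by blast
  have ge: "c \<le> 1 / op_norm (matrix_inv M)" if "M \<in> S" for M
  proof -
    have "norm (matrix_inv M *v u) \<le> (1 / c) * norm u" for u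
      using c(2)[OF that, of "matrix_inv M *v u"] c(1)
      by (simp add: matrix_inv_mult_vector[OF inv[OF that]] field_simps)
    then have "op_norm (matrix_inv M) \<le> 1 / c" unfolding op_norm_def by (rule onorm_le)
    then show ?thesis using c(1) op_norm_matrix_inv_pos[OF inv[OF that]] by (simp add: field_simps)
  qed
  then have "c \<le> m" unfolding m_def using S(2) by (intro cINF_greatest) auto
  with c(1) show "0 < m" by simp
  show "m * norm u \<le> norm (M *v u)" if "M \<in> S"
  proof -
    have "m \<le> 1 / op_norm (matrix_inv M)"
      unfolding m_def using ge that by (intro cINF_lower bdd_belowI2[where m = c])
    then have "m * norm u \<le> 1 / op_norm (matrix_inv M) * norm u" by (intro mult_right_mono) auto
    also have "\<dots> \<le> norm (M *v u)"
      using norm_mult_vector_le_op_norm[of "matrix_inv M" "M *v u"] op_norm_matrix_inv_pos[OF inv[OF that]]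
      by (simp add: matrix_inv_mult_vector[OF inv[OF that]] field_simps)
    finally show ?thesis .
  qed
qed

text \<open>The vectors \<open>M *v v\<close> form a compact convex set. Its point \<open>a\<close>
  closest to 0 satisfies \<open>a \<bullet> a \<le> a \<bullet> (M *v v)\<close> for all
  \<open>M\<close>, so \<open>a\<close>, normalized, is the required direction.\<close>

lemma separating_direction:
  fixes S :: "(real^'n^'m) set"
  assumes S: "compact S" "convex S" "S \<noteq> {}" and v: "0 < c" "\<And>M. M \<in> S \<Longrightarrow> c \<le> norm (M *v v)"
  obtains w where "norm w = 1" "\<And>M. M \<in> S \<Longrightarrow> c \<le> w \<bullet> (M *v v)"
proof -
  let ?T = "(\<lambda>M. M *v v) ` S"
  have "linear (\<lambda>M::real^'n^'m. M *v v)"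
    by (intro linearI) (simp_all add: matrix_vector_mult_add_rdistrib scaleR_matrix_vector_assoc)
  then have "convex ?T" using S(2) by (rule convex_linear_image)
  have "compact ?T" using S(1) by (intro compact_continuous_image continuous_intros)
  then have "closed ?T" by (rule compact_imp_closed)
  define a where "a = closest_point ?T 0"
  have "a \<in> ?T" using \<open>closed ?T\<close> S(3) unfolding a_def by (intro closest_point_in_set) auto
  then have a: "c \<le> norm a" using v(2) by auto
  have "a \<bullet> a \<le> a \<bullet> (M *v v)" if "M \<in> S" for M
    using closest_point_dot[OF \<open>convex ?T\<close> \<open>closed ?T\<close>, of "M *v v" 0] that
    by (simp add: a_def[symmetric] inner_diff_right)
  then have dot: "norm a * norm a \<le> a \<bullet> (M *v v)" if "M \<in> S" for M
    using that by (simp add: dot_square_norm power2_eq_square)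
  have na: "0 < norm a" using a v(1) by linarith
  show thesis
  proof (rule that[of "a /\<^sub>R norm a"])
    show "norm (a /\<^sub>R norm a) = 1" using na by simp
    show "c \<le> (a /\<^sub>R norm a) \<bullet> (M *v v)" if "M \<in> S" for M
    proof -
      have "c \<le> norm a" by (rule a)
      also have "\<dots> \<le> (a \<bullet> (M *v v)) / norm a"
        using dot[OF that] na by (simp only: pos_le_divide_eq)
      also have "\<dots> = (a /\<^sub>R norm a) \<bullet> (M *v v)"
        by (simp add: divide_inverse mult.commute)
      finally show ?thesis .
    qed
  qed
qed

section \<open>The inverse function\<close>

text \<open>The segment from \<^term>\<open>x\<close> to \<^term>\<open>y\<close> may miss the differentiability points altogether; by Fubini
  almost every nearby parallel segment meets them in a set of full measure.\<close>

lemma directional_increment_ge: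
  fixes f :: "real^'n \<Rightarrow> real^'m"
  assumes lip: "K-lipschitz_on UNIV f" and S: "open S" "convex S" and xy: "x \<in> S" "y \<in> S"
    and w: "norm w = 1"
    and jac: "\<And>z. z \<in> S \<Longrightarrow> f differentiable (at z) \<Longrightarrow> c \<le> w \<bullet> (jacobian f (at z) *v (y - x))"
  shows "c \<le> w \<bullet> (f y - f x)"
proof (rule field_le_epsilon)
  fix e :: real assume "0 < e"
  have K: "0 \<le> K" using lip lipschitz_on_nonneg by blast
  define v where "v = y - x"
  \<comment> \<open>Fubini is stated for Borel sets, hence the enlargement to a Borel null
    set.\<close>
  obtain N' where N': "N' \<in> null_sets lborel" "{x. \<not> f differentiable (at x)} \<subseteq> N'"
    using rademacher[OF lip] unfolding negligible_iff_null_sets null_sets_completion_iff2 by blast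
  have "negligible N'" using N'(1) by (simp add: negligible_iff_null_sets null_sets_completionI)
  then have "AE z in lborel. negligible {t::real. z + t *\<^sub>R v \<in> N'}"
    using negligible_iff_AE_lines[of N' v] null_setsD2[OF N'(1)] by simp
  then obtain N where N: "N \<in> null_sets lborel"
    "{z \<in> space lborel. \<not> negligible {t::real. z + t *\<^sub>R v \<in> N'}} \<subseteq> N"
    unfolding eventually_ae_filter by blast
  obtain d1 where d1: "0 < d1" "ball x d1 \<subseteq> S" using S(1) xy(1) by (rule openE)
  obtain d2 where d2: "0 < d2" "ball y d2 \<subseteq> S" using S(1) xy(2) by (rule openE)
  \<comment> \<open>Parallel displacement by less than \<open>d\<close> keeps both endpoints in
    \<open>S\<close> and changes the increment of \<open>f\<close> by at most
    \<open>2 * K * d\<close>, hence by at most \<open>e\<close>.\<close>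
  define d where "d = min (min d1 d2) (e / (2 * (K + 1)))"
  have d: "0 < d" "d \<le> d1" "d \<le> d2" "d \<le> e / (2 * (K + 1))"
    using d1(1) d2(1) \<open>0 < e\<close> K by (auto simp: d_def)
  have "\<not> ball x d \<subseteq> N"
  proof
    assume "ball x d \<subseteq> N"
    moreover have "negligible N" using N(1) by (simp add: negligible_iff_null_sets null_sets_completionI)
    ultimately have "negligible (ball x d)" using negligible_subset by blast
    then show False using open_not_negligible[of "ball x d"] d(1) by simp
  qed
  \<comment> \<open>A ball is not null, so some starting point in it avoids the exceptional set of
    lines.\<close>
  then obtain z where "z \<in> ball x d" and zN: "z \<notin> N" by blast
  then have z: "dist x z < d" by simp
  then have neg: "negligible {t::real. z + t *\<^sub>R v \<in> N'}" using N(2) zN by auto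
  have "z \<in> S" using z d d1(2) by auto
  have "dist y (z + v) = dist x z" by (simp add: v_def dist_norm)
  then have "z + v \<in> S" using z d d2(2) by auto
  define h where "h t = w \<bullet> f (z + t *\<^sub>R v)" for t
  have hlip: "(K * norm v)-lipschitz_on UNIV h"
  proof (rule lipschitz_onI)
    fix s t
    have "\<bar>w \<bullet> (f (z + s *\<^sub>R v) - f (z + t *\<^sub>R v))\<bar> \<le> norm (f (z + s *\<^sub>R v) - f (z + t *\<^sub>R v))"
      using Cauchy_Schwarz_ineq2[of w "f (z + s *\<^sub>R v) - f (z + t *\<^sub>R v)"] w by simp
    also have "\<dots> \<le> K * norm v * dist s t"
      using lipschitz_onD[OF lipschitz_on_line[OF lip, of v z], of s t] by (simp add: dist_norm)
    finally show "dist (h s) (h t) \<le> K * norm v * dist s t"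
      by (simp add: h_def dist_real_def inner_diff_right)
  qed (use K in simp)
  have "c \<le> h 1 - h 0"
  proof (rule lipschitz_increment_ge[OF hlip neg])
    fix t :: real assume t: "t \<in> {0..1}" "t \<notin> {t. z + t *\<^sub>R v \<in> N'}"
    let ?z = "z + t *\<^sub>R v"
    have diff: "f differentiable (at ?z)" using t(2) N'(2) by auto
    have "?z = (1 - t) *\<^sub>R z + t *\<^sub>R (z + v)" by (simp add: algebra_simps)
    then have "?z \<in> S" using S(2) \<open>z \<in> S\<close> \<open>z + v \<in> S\<close> t(1) by (auto simp: convex_alt)
    have "(f has_derivative (\<lambda>k. jacobian f (at ?z) *v k)) (at ?z)"
      using diff by (simp add: jacobian_works)
    moreover have "((\<lambda>s. z + s *\<^sub>R v) has_derivative (\<lambda>s. s *\<^sub>R v)) (at t)"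
      by (auto intro!: derivative_eq_intros)
    ultimately have "((\<lambda>s. f (z + s *\<^sub>R v)) has_derivative (\<lambda>s. jacobian f (at ?z) *v (s *\<^sub>R v))) (at t)"
      using has_derivative_compose by blast
    then have "(h has_derivative (\<lambda>s. w \<bullet> (jacobian f (at ?z) *v (s *\<^sub>R v)))) (at t)"
      unfolding h_def by (rule has_derivative_inner_right)
    then have "(h has_real_derivative w \<bullet> (jacobian f (at ?z) *v v)) (at t)"
      by (rule has_derivative_imp_has_field_derivative) (simp add: matrix_vector_mult_scaleR)
    moreover have "c \<le> w \<bullet> (jacobian f (at ?z) *v v)"
      using jac[OF \<open>?z \<in> S\<close> diff] by (simp add: v_def)
    ultimately show "\<exists>D\<ge>c. (h has_real_derivative D) (at t)" by blast
  qed
  also have "h 1 - h 0 = w \<bullet> (f y - f x) + w \<bullet> ((f (z + v) - f y) + (f x - f z))"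
    by (simp add: h_def inner_diff_right inner_add_right)
  also have "w \<bullet> ((f (z + v) - f y) + (f x - f z)) \<le> norm ((f (z + v) - f y) + (f x - f z))"
    using norm_cauchy_schwarz[of w "(f (z + v) - f y) + (f x - f z)"] w by simp
  also have "\<dots> \<le> norm (f (z + v) - f y) + norm (f x - f z)" by (rule norm_triangle_ineq)
  also have "\<dots> \<le> K * d + K * d"
  proof (rule add_mono)
    have "norm (f (z + v) - f y) \<le> K * dist y (z + v)"
      using lipschitz_onD[OF lip, of "z + v" y] by (simp add: dist_norm norm_minus_commute)
    also have "\<dots> \<le> K * d" using \<open>dist y (z + v) = _\<close> z K by (intro mult_left_mono) auto
    finally show "norm (f (z + v) - f y) \<le> K * d" .
    have "norm (f x - f z) \<le> K * dist x z"
      using lipschitz_onD[OF lip, of x z] by (simp add: dist_norm)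
    also have "\<dots> \<le> K * d" using z K by (intro mult_left_mono) auto
    finally show "norm (f x - f z) \<le> K * d" .
  qed
  also have "\<dots> \<le> 2 * (K + 1) * d" using d(1) by (simp add: algebra_simps)
  also have "\<dots> \<le> e" using d(4) K by (simp add: field_simps)
  finally show "c \<le> w \<bullet> (f y - f x) + e" by simp
qed

text \<open>The image of the open ball is open by invariance of domain. It is also relatively closed
  in the target ball, because boundary points of the domain are sent to distance at least
  \<open>\<delta> * r\<close> from \<open>f x0\<close>. Connectedness of the target ball does the
  rest.\<close>

lemma ball_subset_image_of_expanding:
  fixes f :: "'a::euclidean_space \<Rightarrow> 'a"
  assumes cont: "continuous_on UNIV f" and \<delta>: "0 < \<delta>" and r: "0 < r"
    and expand: "\<And>x y. x \<in> ball x0 r \<Longrightarrow> y \<in> ball x0 r \<Longrightarrow> \<delta> * norm (x - y) \<le> norm (f x - f y)"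
  shows "ball (f x0) (\<delta> * r) \<subseteq> f ` ball x0 r"
proof -
  let ?S = "f ` ball x0 r" and ?B = "ball (f x0) (\<delta> * r)"
  have "inj_on f (ball x0 r)"
  proof (rule inj_onI)
    fix x y assume "x \<in> ball x0 r" "y \<in> ball x0 r" "f x = f y"
    with expand[of x y] \<delta> show "x = y" by (simp add: mult_le_0_iff)
  qed
  then have "open ?S"
    using invariance_of_domain[of "ball x0 r" f] cont continuous_on_subset by blast
  have closed: "v \<in> ?S" if v: "v \<in> ?B" "v \<in> closure ?S" for v
  proof -
    have "compact (f ` cball x0 r)"
      using cont continuous_on_subset by (intro compact_continuous_image) auto
    then have "closure ?S \<subseteq> f ` cball x0 r"
      by (intro closure_minimal compact_imp_closed) auto
    with v(2) obtain x where x: "x \<in> cball x0 r" "v = f x" by auto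
    \<comment> \<open>By continuity the expansion from \<open>x0\<close> persists on the closed
      ball.\<close>
    have "\<delta> * norm (x - x0) - norm (f x - f x0) \<le> 0"
    proof (rule continuous_le_on_closure[of "ball x0 r" "\<lambda>x. \<delta> * norm (x - x0) - norm (f x - f x0)"])
      show "continuous_on (closure (ball x0 r)) (\<lambda>x. \<delta> * norm (x - x0) - norm (f x - f x0))"
        by (intro continuous_intros continuous_on_subset[OF cont]) auto
      show "x \<in> closure (ball x0 r)" using x(1) r by simp
      show "\<delta> * norm (y - x0) - norm (f y - f x0) \<le> 0" if "y \<in> ball x0 r" for y
        using expand[OF that, of x0] r by simp
    qed
    moreover have "norm (f x - f x0) < \<delta> * r" using v(1) x(2) by (simp add: dist_norm norm_minus_commute)
    ultimately have "\<delta> * norm (x - x0) < \<delta> * r" by linarith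
    then have "x \<in> ball x0 r" using \<delta> by (simp add: dist_norm norm_minus_commute)
    with x(2) show ?thesis by blast
  qed
  have "?S \<inter> ?B = {} \<or> - closure ?S \<inter> ?B = {}"
  proof (rule connectedD)
    show "?S \<inter> - closure ?S \<inter> ?B = {}" using closure_subset[of ?S] by auto
    show "?B \<subseteq> ?S \<union> - closure ?S" using closed by auto
  qed (use \<open>open ?S\<close> in auto)
  moreover have "f x0 \<in> ?S \<inter> ?B" using \<delta> r by auto
  ultimately have "?B \<subseteq> closure ?S" by blast
  then show ?thesis using closed by blast
qed

theorem theorem3p1:
  fixes f :: "real^'n \<Rightarrow> real^'n" and x0 :: "real^'n" and K \<delta> r :: real
  assumes f_lipschitz: "K-lipschitz_on UNIV f"
    and maximal_rank: "\<forall>M\<in>generalized_jacobian f x0. invertible M"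
    and delta: "\<delta> = 1/2 * (INF M\<in>generalized_jacobian f x0. 1 / op_norm (matrix_inv M))"
    and r_pos: "r > 0"
    and r_lipschitz: "\<forall>x\<in>ball x0 r. \<forall>y\<in>ball x0 r. norm (f x - f y) \<le> K * norm (x - y)"
    and r_jacobian: "\<forall>x\<in>ball x0 r. generalized_jacobian f x
           \<subseteq> generalized_jacobian f x0 + (*\<^sub>R) \<delta> ` op_unit_ball"
  shows "\<exists>U V g. U = ball x0 (r * \<delta> / 2 * (1 / K)) \<and> V = ball (f x0) (r * \<delta> / 2)
           \<and> x0 \<in> interior U \<and> f x0 \<in> interior V
           \<and> (\<exists>C. C-lipschitz_on V g) \<and> lipschitz_constant V g \<le> ennreal (1 / \<delta>)
           \<and> f ` U \<subseteq> V
           \<and> (\<forall>u\<in>U. g (f u) = u)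
           \<and> (\<forall>v\<in>V. f (g v) = v)"
proof -
  let ?G = "generalized_jacobian f x0" and ?B = "ball x0 r"
  have G: "compact ?G" "?G \<noteq> {}"
    using compact_generalized_jacobian generalized_jacobian_nonempty f_lipschitz by blast+
  have inv: "\<And>M. M \<in> ?G \<Longrightarrow> invertible M" using maximal_rank by blast
  have convex: "convex ?G" unfolding generalized_jacobian_def by (rule convex_convex_hull)
  have inf: "(INF M\<in>?G. 1 / op_norm (matrix_inv M)) = 2 * \<delta>" using delta by simp
  have \<delta>: "0 < \<delta>" using infimum_inverse_norm(1)[OF G inv] inf by simp
  have low: "2 * \<delta> * norm u \<le> norm (M *v u)" if "M \<in> ?G" for M u
    using infimum_inverse_norm(2)[OF G inv that, of u] unfolding inf by simp
  have expand: "\<delta> * norm (y - x) \<le> norm (f y - f x)" if xy: "x \<in> ?B" "y \<in> ?B" for x y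
  proof (cases "x = y")
    case False
    define v where "v = y - x"
    have "0 < 2 * \<delta> * norm v" using False \<delta> by (simp add: v_def)
    \<comment> \<open>One direction \<open>w\<close> serves all \<open>M\<close> because the
      generalized Jacobian is convex. The perturbation by \<open>\<delta> *\<^sub>R C\<close> then
      uses up half of the margin \<open>2 * \<delta> * norm v\<close>.\<close>
    then obtain w where w: "norm w = 1" "\<And>M. M \<in> ?G \<Longrightarrow> 2 * \<delta> * norm v \<le> w \<bullet> (M *v v)"
      using separating_direction[OF G(1) convex G(2), of "2 * \<delta> * norm v" v] low by blast
    have "\<delta> * norm v \<le> w \<bullet> (f y - f x)"
    proof (rule directional_increment_ge[OF f_lipschitz _ _ xy w(1)])
      fix z assume z: "z \<in> ?B" "f differentiable (at z)"
      have "jacobian f (at z) \<in> ?G + (*\<^sub>R) \<delta> ` op_unit_ball"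
        using jacobian_in_generalized_jacobian[OF z(2)] r_jacobian z(1) by blast
      then obtain M C where M: "M \<in> ?G" and C: "op_norm C \<le> 1" and J: "jacobian f (at z) = M + \<delta> *\<^sub>R C"
        unfolding op_unit_ball_def by (auto elim!: set_plus_elim)
      have "\<bar>w \<bullet> (C *v v)\<bar> \<le> norm (C *v v)"
        using Cauchy_Schwarz_ineq2[of w "C *v v"] w(1) by simp
      also have "\<dots> \<le> op_norm C * norm v" by (rule norm_mult_vector_le_op_norm)
      also have "\<dots> \<le> norm v" using C mult_right_mono[of "op_norm C" 1 "norm v"] by simp
      finally have "- norm v \<le> w \<bullet> (C *v v)" by linarith
      then have "\<delta> * - norm v \<le> \<delta> * (w \<bullet> (C *v v))" using \<delta> by (intro mult_left_mono) auto
      moreover have "w \<bullet> (jacobian f (at z) *v v) = w \<bullet> (M *v v) + \<delta> * (w \<bullet> (C *v v))"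
        by (simp add: J matrix_vector_mult_add_rdistrib scaleR_matrix_vector_assoc[symmetric] inner_add_right)
      ultimately show "\<delta> * norm v \<le> w \<bullet> (jacobian f (at z) *v (y - x))"
        using w(2)[OF M] by (simp add: v_def)
    qed auto
    also have "\<dots> \<le> norm (f y - f x)" using norm_cauchy_schwarz[of w "f y - f x"] w(1) by simp
    finally show ?thesis by (simp add: v_def)
  qed simp
  \<comment> \<open>Expansion and the Lipschitz bound, compared at one point, give
    \<open>\<delta> \<le> K\<close>. This makes \<open>1 / K\<close> a genuine reciprocal and places
    \<open>U\<close> inside the ball of radius \<open>r\<close>.\<close>
  have \<delta>K: "\<delta> \<le> K"
  proof -
    obtain u :: "real^'n" where u: "norm u = r / 2" using vector_choose_size[of "r / 2"] r_pos by auto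
    have "x0 + u \<in> ?B" using u r_pos by (simp add: dist_norm)
    then have "\<delta> * norm u \<le> norm (f (x0 + u) - f x0)"
      using expand[of x0 "x0 + u"] r_pos by simp
    also have "\<dots> \<le> K * norm u"
      using lipschitz_onD[OF f_lipschitz, of "x0 + u" x0] by (simp add: dist_norm)
    finally show ?thesis using u r_pos by simp
  qed
  then have K: "0 < K" using \<delta> by simp
  have inj: "x = y" if "x \<in> ?B" "y \<in> ?B" "f x = f y" for x y
    using expand[OF that(1,2)] that(3) \<delta> by (simp add: mult_le_0_iff)
  define U where "U = ball x0 (r * \<delta> / 2 * (1 / K))"
  define V where "V = ball (f x0) (r * \<delta> / 2)"
  \<comment> \<open>The inverse is taken on the whole ball of radius \<open>r\<close>, where
    \<open>f\<close> is injective; its image contains the ball of radius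
    \<open>\<delta> * r\<close>, twice the radius of \<open>V\<close>.\<close>
  define g where "g = inv_into ?B f"
  have "V \<subseteq> ball (f x0) (\<delta> * r)"
    unfolding V_def using mult_pos_pos[OF \<delta> r_pos] by (intro subset_ball) (simp add: mult.commute)
  also have "\<dots> \<subseteq> f ` ?B"
    by (rule ball_subset_image_of_expanding[OF lipschitz_on_continuous_on[OF f_lipschitz] \<delta> r_pos])
       (blast intro: expand)
  finally have V: "V \<subseteq> f ` ?B" .
  have fg: "f (g v) = v" "g v \<in> ?B" if "v \<in> V" for v
    using subsetD[OF V that] unfolding g_def by (rule f_inv_into_f, rule inv_into_into)
  have glip: "norm (g v - g w) \<le> 1 / \<delta> * norm (v - w)" if "v \<in> V" "w \<in> V" for v w
    using expand[OF fg(2)[OF that(2)] fg(2)[OF that(1)]] fg(1) that \<delta> by (simp add: field_simps)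
  have "U \<subseteq> ?B"
  proof -
    have "r * \<delta> / 2 * (1 / K) \<le> r" using \<delta>K \<delta> K r_pos by (simp add: field_simps)
    then show ?thesis unfolding U_def by (rule subset_ball)
  qed
  have fU: "f ` U \<subseteq> V"
  proof
    fix v assume "v \<in> f ` U"
    then obtain u where u: "u \<in> U" "v = f u" by blast
    have "dist (f x0) (f u) \<le> K * dist x0 u" by (rule lipschitz_onD[OF f_lipschitz]) auto
    also have "\<dots> < K * (r * \<delta> / 2 * (1 / K))"
      using u(1) K by (intro mult_strict_left_mono) (auto simp: U_def)
    also have "\<dots> = r * \<delta> / 2" using K by simp
    finally show "v \<in> V" by (simp add: V_def u(2))
  qed
  have "g (f u) = u" if "u \<in> U" for u
    using fg[of "f u"] inj[of "g (f u)" u] that fU \<open>U \<subseteq> ?B\<close> by blast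
  moreover have "(1 / \<delta>)-lipschitz_on V g"
    using glip \<delta> by (intro lipschitz_onI) (auto simp: dist_norm)
  moreover have "lipschitz_constant V g \<le> ennreal (1 / \<delta>)"
    unfolding lipschitz_constant_def
    using glip by (intro SUP_least) (auto intro!: ennreal_leI simp: divide_le_eq)
  moreover have "x0 \<in> interior U" "f x0 \<in> interior V"
    using \<delta> K r_pos by (auto simp: U_def V_def interior_open)
  ultimately show ?thesis
    using fg(1) fU by (intro exI[of _ U] exI[of _ V] exI[of _ g]) (auto simp: U_def V_def)
qed

end
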